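(* For every fixed integer $c\ge 2$, \textsc{$c$-Closed Vertex Deletion} admits a kernel with $\mathcal{O}(k^{c+2})$ vertices that can be computed in $\mathcal{O}(n^3+n^2m)$ time, where $n$ and $m$ are the numbers of vertices and edges of the input graph.
   Context: A graph is $c$-closed if every pair of distinct nonadjacent vertices has at most $c-1$ common neighbors. \textsc{$c$-Closed Vertex Deletion}: given a graph $G=(V,E)$ and a positive integer $k$, decide whether there is $S\subseteq V$ with $|S|\le k$ such that $G-S$ is $c$-closed; the parameter is $k$. A kernel maps each instance $(G,k)$ to an equivalent instance $(G',k')$ whose size is bounded by a function of $k$. *)

theory Defs
  imports Main
begin

section \<open>Graphs and the deletion problem\<close>

type_synonym 'a graph = "'a set \<times> 'a set set"

abbreviation (input) verts :: "'a graph \<Rightarrow> 'a set" where "verts \<equiv> fst"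
abbreviation (input) edges :: "'a graph \<Rightarrow> 'a set set" where "edges \<equiv> snd"

definition simple_graph :: "'a graph \<Rightarrow> bool" where
  "simple_graph G \<longleftrightarrow> finite (verts G) \<and> edges G \<subseteq> {e. e \<subseteq> verts G \<and> card e = 2}"

definition adjacent :: "'a graph \<Rightarrow> 'a \<Rightarrow> 'a \<Rightarrow> bool" where
  "adjacent G u v \<longleftrightarrow> {u, v} \<in> edges G"

definition neighbors :: "'a graph \<Rightarrow> 'a \<Rightarrow> 'a set" where
  "neighbors G v = {u \<in> verts G. adjacent G u v}"

definition c_closed :: "nat \<Rightarrow> 'a graph \<Rightarrow> bool" where
  "c_closed c G \<longleftrightarrow>
     (\<forall>u\<in>verts G. \<forall>v\<in>verts G. u \<noteq> v \<and> \<not> adjacent G u v \<longrightarrow>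
        card (neighbors G u \<inter> neighbors G v) \<le> c - 1)"

definition delete_verts :: "'a graph \<Rightarrow> 'a set \<Rightarrow> 'a graph" where
  "delete_verts G S = (verts G - S, {e \<in> edges G. e \<inter> S = {}})"

definition c_closed_vertex_deletion :: "nat \<Rightarrow> 'a graph \<times> nat \<Rightarrow> bool" where
  "c_closed_vertex_deletion c = (\<lambda>(G, k).
     \<exists>S \<subseteq> verts G. card S \<le> k \<and> c_closed c (delete_verts G S))"

section \<open>Machine model\<close>

text \<open>
  Random access machine with uniform cost, presented as a while language. The memory is a family
  of named unbounded arrays of natural numbers; a scalar variable is cell 0 of its array. The only
  arithmetic operations are addition and truncated subtraction: with multiplication, uniform cost
  on unbounded numbers would not be a realistic measure of time.
\<close>

type_synonym store = "string \<Rightarrow> nat \<Rightarrow> nat"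

datatype aexp = Const nat | Read string aexp | Add aexp aexp | Sub aexp aexp

datatype bexp = Less aexp aexp | Neg bexp | Conj bexp bexp

datatype com =
    Skip
  | Write string aexp aexp
  | Seq com com
  | Cond bexp com com
  | While bexp com

fun aval :: "aexp \<Rightarrow> store \<Rightarrow> nat" where
  "aval (Const n) s = n"
| "aval (Read x a) s = s x (aval a s)"
| "aval (Add a b) s = aval a s + aval b s"
| "aval (Sub a b) s = aval a s - aval b s"

fun bval :: "bexp \<Rightarrow> store \<Rightarrow> bool" where
  "bval (Less a b) s \<longleftrightarrow> aval a s < aval b s"
| "bval (Neg b) s \<longleftrightarrow> \<not> bval b s"
| "bval (Conj a b) s \<longleftrightarrow> bval a s \<and> bval b s"

text \<open>
  \<open>exec P s t s'\<close>: program \<open>P\<close> started in \<open>s\<close> halts in \<open>s'\<close> after \<open>t\<close> steps. One step is one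
  assignment or one test. Evaluating an expression takes a number of elementary operations that
  is fixed by the program text, so this agrees up to a constant factor depending only on the
  program with counting every elementary operation.
\<close>

inductive exec :: "com \<Rightarrow> store \<Rightarrow> nat \<Rightarrow> store \<Rightarrow> bool" where
  Skip: "exec Skip s 1 s"
| Write: "exec (Write x i a) s 1 (s(x := (s x)(aval i s := aval a s)))"
| Seq: "exec P s t s' \<Longrightarrow> exec Q s' t' s'' \<Longrightarrow> exec (Seq P Q) s (t + t') s''"
| CondTrue: "bval b s \<Longrightarrow> exec P s t s' \<Longrightarrow> exec (Cond b P Q) s (1 + t) s'"
| CondFalse: "\<not> bval b s \<Longrightarrow> exec Q s t s' \<Longrightarrow> exec (Cond b P Q) s (1 + t) s'"
| WhileFalse: "\<not> bval b s \<Longrightarrow> exec (While b P) s 1 s"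
| WhileTrue: "bval b s \<Longrightarrow> exec P s t s' \<Longrightarrow> exec (While b P) s' t' s'' \<Longrightarrow>
    exec (While b P) s (1 + t + t') s''"

inductive_cases exec_SkipE: "exec Skip s t s'"
inductive_cases exec_WriteE: "exec (Write x i a) s t s'"
inductive_cases exec_SeqE: "exec (Seq P Q) s t s'"
inductive_cases exec_CondE: "exec (Cond b P Q) s t s'"
inductive_cases exec_WhileE: "exec (While b P) s t s'"

lemma exec_deterministic:
  "exec P s t s' \<Longrightarrow> exec P s u s'' \<Longrightarrow> t = u \<and> s' = s''"
proof (induction arbitrary: u s'' rule: exec.induct)
  case (Skip s)
  then show ?case by (elim exec_SkipE) simp
next
  case (Write x i a s)
  then show ?case by (elim exec_WriteE) simp
next
  case (Seq P s t s1 Q t' s2)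
  from Seq.prems show ?case by (elim exec_SeqE) (auto dest!: Seq.IH)
next
  case (CondTrue b s P t s' Q)
  from CondTrue.prems CondTrue.hyps(1) show ?case
    by (elim exec_CondE) (auto dest!: CondTrue.IH)
next
  case (CondFalse b s Q t s' P)
  from CondFalse.prems CondFalse.hyps(1) show ?case
    by (elim exec_CondE) (auto dest!: CondFalse.IH)
next
  case (WhileFalse b s P)
  from WhileFalse.prems show ?case
    by (rule exec_WhileE) (use WhileFalse.hyps in auto)
next
  case (WhileTrue b s P t s1 t' s2)
  from WhileTrue.prems show ?case
  proof (rule exec_WhileE)
    fix v r w
    assume *: "u = Suc (v + w)" "exec P s v r" "exec (While b P) r w s''"
    from WhileTrue.IH(1)[OF *(2)] have "t = v" "s1 = r" by simp_all
    with WhileTrue.IH(2)[of w s''] * show ?thesis by simp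
  qed (use WhileTrue.hyps in auto)
qed

section \<open>Instances and kernels\<close>

text \<open>Machines receive graphs with vertex set \<open>{0, \<dots>, n - 1}\<close>.\<close>

definition valid_instance :: "nat graph \<times> nat \<Rightarrow> bool" where
  "valid_instance = (\<lambda>(G, k). simple_graph G \<and> verts G = {..<card (verts G)} \<and> 0 < k)"

text \<open>
  An instance is stored as the number of vertices in \<open>''n''\<close>, the parameter in \<open>''k''\<close> and the
  row-major adjacency matrix in \<open>''A''\<close>. On input, every other cell is 0; on output, the remaining
  cells are irrelevant.
\<close>

definition stores :: "store \<Rightarrow> nat graph \<times> nat \<Rightarrow> bool" where
  "stores s = (\<lambda>(G, k). let n = card (verts G) in
     s ''n'' 0 = n \<and> s ''k'' 0 = k \<and>
     (\<forall>i<n. \<forall>j<n. s ''A'' (i * n + j) = (if adjacent G i j then 1 else 0)))"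

definition instance_cells :: "nat \<Rightarrow> (string \<times> nat) set" where
  "instance_cells n = {(''n'', 0), (''k'', 0)} \<union> {''A''} \<times> {..<n * n}"

definition input_store :: "store \<Rightarrow> nat graph \<times> nat \<Rightarrow> bool" where
  "input_store s I \<longleftrightarrow> stores s I \<and>
     (\<forall>x i. (x, i) \<notin> instance_cells (card (verts (fst I))) \<longrightarrow> s x i = 0)"

definition computes_within ::
    "com \<Rightarrow> (nat graph \<times> nat \<Rightarrow> nat graph \<times> nat) \<Rightarrow> (nat graph \<times> nat \<Rightarrow> nat) \<Rightarrow> bool" where
  "computes_within P f T \<longleftrightarrow>
     (\<forall>I s. valid_instance I \<and> input_store s I \<longrightarrow>
        (\<exists>t s'. exec P s t s' \<and> stores s' (f I) \<and> t \<le> T I))"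

definition instance_size :: "'a graph \<times> nat \<Rightarrow> nat" where
  "instance_size = (\<lambda>(G, k). card (verts G) + card (edges G) + k)"

definition is_kernel ::
    "(nat graph \<times> nat \<Rightarrow> bool) \<Rightarrow> (nat graph \<times> nat \<Rightarrow> nat graph \<times> nat) \<Rightarrow> bool" where
  "is_kernel L f \<longleftrightarrow>
     (\<exists>g :: nat \<Rightarrow> nat. \<forall>G k. valid_instance (G, k) \<longrightarrow>
        valid_instance (f (G, k)) \<and> (L (f (G, k)) \<longleftrightarrow> L (G, k)) \<and>
        instance_size (f (G, k)) \<le> g k)"

end

theory Submission
  imports Defs
begin

text \<open>
  A graph is \<open>c\<close>-closed iff it has no obstruction: nonadjacent \<open>u \<noteq> v\<close> together with \<open>c\<close> common
  neighbors. Obstructions are written as tuples of length \<open>d = c + 2\<close>. They are scanned one by one,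
  and a tuple is kept unless for some set \<open>I\<close> of positions already \<open>cap (d - card I)\<close> kept tuples
  agree with it on \<open>I\<close>, where \<open>cap 0 = 1\<close> and \<open>cap (j + 1) = 1 + d k cap j\<close>. If such a set \<open>I\<close>
  exists, then every \<open>S\<close> with \<open>card S \<le> k\<close> that hits all kept tuples hits the given one on \<open>I\<close>:
  otherwise each of the \<open>cap (d - card I)\<close> tuples would be hit at one of at most \<open>d\<close> further
  positions by one of at most \<open>k\<close> vertices, and for each such choice there are at most
  \<open>cap (d - card I - 1)\<close> of them. So the kept tuples have the same hitting sets of size at most \<open>k\<close>
  as all obstructions, and the subgraph induced by their vertices is an equivalent instance with at
  most \<open>d cap d = O(k\<^bsup>c + 2\<^esup>)\<close> vertices.

  For a fixed pair \<open>u, v\<close> it suffices to look at \<open>k + c\<close> common neighbors, which gives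
  \<open>O(k\<^sup>c)\<close> tuples. If \<open>cap d \<ge> n\<close> the instance is small already, and otherwise
  \<open>k\<^sup>c \<le> n\<close>, so the scan takes time \<open>O(n\<^sup>3)\<close>.
\<close>

section \<open>Closedness relative to a vertex set\<close>

definition common_neighbors :: "'a set \<Rightarrow> ('a \<Rightarrow> 'a \<Rightarrow> bool) \<Rightarrow> 'a \<Rightarrow> 'a \<Rightarrow> 'a set" where
  "common_neighbors V adj u v = {w \<in> V. adj u w \<and> adj v w}"

definition closed_on :: "nat \<Rightarrow> 'a set \<Rightarrow> ('a \<Rightarrow> 'a \<Rightarrow> bool) \<Rightarrow> bool" where
  "closed_on c V adj \<longleftrightarrow>
     (\<forall>u\<in>V. \<forall>v\<in>V. u \<noteq> v \<and> \<not> adj u v \<longrightarrow> card (common_neighbors V adj u v) < c)"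

definition has_closed_deletion :: "nat \<Rightarrow> nat \<Rightarrow> 'a set \<Rightarrow> ('a \<Rightarrow> 'a \<Rightarrow> bool) \<Rightarrow> bool" where
  "has_closed_deletion c k V adj \<longleftrightarrow> (\<exists>S\<subseteq>V. card S \<le> k \<and> closed_on c (V - S) adj)"

definition obstruction :: "nat \<Rightarrow> 'a set \<Rightarrow> ('a \<Rightarrow> 'a \<Rightarrow> bool) \<Rightarrow> 'a list \<Rightarrow> bool" where
  "obstruction c V adj t \<longleftrightarrow> (\<exists>u v ws. t = u # v # ws \<and> u \<in> V \<and> v \<in> V \<and> u \<noteq> v \<and> \<not> adj u v \<and>
     set ws \<subseteq> common_neighbors V adj u v \<and> distinct ws \<and> length ws = c)"

lemma length_obstruction: "obstruction c V adj t \<Longrightarrow> length t = c + 2"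
  by (auto simp: obstruction_def)

lemma set_obstruction: "obstruction c V adj t \<Longrightarrow> set t \<subseteq> V"
  by (auto simp: obstruction_def common_neighbors_def)

lemma obstruction_subset: "obstruction c V adj t \<Longrightarrow> set t \<subseteq> U \<Longrightarrow> obstruction c U adj t"
  by (auto simp: obstruction_def common_neighbors_def)

lemma closed_on_iff_no_obstruction:
  assumes "finite V"
  shows "closed_on c V adj \<longleftrightarrow> (\<forall>t. \<not> obstruction c V adj t)"
proof -
  have finite: "finite (common_neighbors V adj u v)" for u v
    using assms by (simp add: common_neighbors_def)
  have "c \<le> card (common_neighbors V adj u v) \<longleftrightarrow>
      (\<exists>ws. set ws \<subseteq> common_neighbors V adj u v \<and> distinct ws \<and> length ws = c)" for u v
  proof
    assume "c \<le> card (common_neighbors V adj u v)"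
    then obtain C where "C \<subseteq> common_neighbors V adj u v" "card C = c"
      by (meson obtain_subset_with_card_n)
    moreover then obtain ws where "set ws = C" "distinct ws"
      using finite finite_distinct_list finite_subset by metis
    ultimately show "\<exists>ws. set ws \<subseteq> common_neighbors V adj u v \<and> distinct ws \<and> length ws = c"
      using distinct_card by metis
  next
    assume "\<exists>ws. set ws \<subseteq> common_neighbors V adj u v \<and> distinct ws \<and> length ws = c"
    then show "c \<le> card (common_neighbors V adj u v)"
      using card_mono[OF finite] distinct_card by metis
  qed
  then have "card (common_neighbors V adj u v) < c \<longleftrightarrow>
      \<not> (\<exists>ws. set ws \<subseteq> common_neighbors V adj u v \<and> distinct ws \<and> length ws = c)" for u v
    by (simp only: flip: not_le)
  then have "closed_on c V adj \<longleftrightarrow> (\<forall>u\<in>V. \<forall>v\<in>V. u \<noteq> v \<and> \<not> adj u v \<longrightarrow>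
      \<not> (\<exists>ws. set ws \<subseteq> common_neighbors V adj u v \<and> distinct ws \<and> length ws = c))"
    by (simp only: closed_on_def)
  then show ?thesis
    by (simp only: obstruction_def) blast
qed

lemma closed_on_Diff_iff_hitting:
  assumes "finite V"
  shows "closed_on c (V - S) adj \<longleftrightarrow> (\<forall>t. obstruction c V adj t \<longrightarrow> set t \<inter> S \<noteq> {})"
proof -
  have "obstruction c (V - S) adj t \<longleftrightarrow> obstruction c V adj t \<and> set t \<inter> S = {}" for t
    by (auto simp: obstruction_def common_neighbors_def)
  then show ?thesis
    using assms by (simp add: closed_on_iff_no_obstruction)
qed

lemma closed_on_subset:
  assumes "closed_on c V adj" "U \<subseteq> V" "finite V"
  shows "closed_on c U adj"
proof -
  have "finite U"
    using assms finite_subset by blast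
  moreover have "obstruction c V adj t" if "obstruction c U adj t" for t
    using that set_obstruction[OF that] assms(2) by (blast intro: obstruction_subset)
  ultimately show ?thesis
    using assms by (auto simp: closed_on_iff_no_obstruction)
qed

lemma closed_on_inj_image:
  assumes inj: "inj_on h V"
    and adj: "\<And>i j. i \<in> V \<Longrightarrow> j \<in> V \<Longrightarrow> adj' i j \<longleftrightarrow> adj (h i) (h j)"
  shows "closed_on c (h ` V) adj \<longleftrightarrow> closed_on c V adj'"
proof -
  have "card (common_neighbors (h ` V) adj (h i) (h j)) = card (common_neighbors V adj' i j)"
    if "i \<in> V" "j \<in> V" for i j
  proof -
    have "common_neighbors (h ` V) adj (h i) (h j) = h ` common_neighbors V adj' i j"
      using that adj by (auto simp: common_neighbors_def)
    moreover have "inj_on h (common_neighbors V adj' i j)"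
      by (rule inj_on_subset[OF inj]) (auto simp: common_neighbors_def)
    ultimately show ?thesis
      by (simp add: card_image)
  qed
  then show ?thesis
    using adj inj_on_eq_iff[OF inj] by (simp add: closed_on_def)
qed

lemma has_closed_deletion_inj_image:
  assumes inj: "inj_on h V"
    and adj: "\<And>i j. i \<in> V \<Longrightarrow> j \<in> V \<Longrightarrow> adj' i j \<longleftrightarrow> adj (h i) (h j)"
  shows "has_closed_deletion c k (h ` V) adj \<longleftrightarrow> has_closed_deletion c k V adj'"
proof -
  have "card (h ` S) = card S \<and> (closed_on c (h ` V - h ` S) adj \<longleftrightarrow> closed_on c (V - S) adj')"
    if "S \<subseteq> V" for S
  proof
    show "card (h ` S) = card S"
      by (rule card_image) (rule inj_on_subset[OF inj that])
    have "h ` V - h ` S = h ` (V - S)"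
      by (rule inj_on_image_set_diff[OF inj, symmetric]) (use that in auto)
    then show "closed_on c (h ` V - h ` S) adj \<longleftrightarrow> closed_on c (V - S) adj'"
      using closed_on_inj_image[of h "V - S" adj' adj c] inj_on_subset[OF inj] adj by simp
  qed
  moreover have "has_closed_deletion c k (h ` V) adj \<longleftrightarrow>
      (\<exists>S\<subseteq>V. card (h ` S) \<le> k \<and> closed_on c (h ` V - h ` S) adj)"
    by (auto simp: has_closed_deletion_def subset_image_iff)
  ultimately show ?thesis
    by (simp add: has_closed_deletion_def cong: conj_cong)
qed

lemma adjacent_commute: "adjacent G u v \<longleftrightarrow> adjacent G v u"
  by (simp add: adjacent_def insert_commute)

lemma c_closed_delete_verts:
  assumes "1 \<le> c"
  shows "c_closed c (delete_verts G S) \<longleftrightarrow> closed_on c (verts G - S) (adjacent G)"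
proof -
  have adj: "adjacent (delete_verts G S) u v \<longleftrightarrow> adjacent G u v"
    if "u \<in> verts G - S" "v \<in> verts G - S" for u v
    using that by (auto simp: adjacent_def delete_verts_def)
  have "neighbors (delete_verts G S) u \<inter> neighbors (delete_verts G S) v =
      common_neighbors (verts G - S) (adjacent G) u v"
    if "u \<in> verts G - S" "v \<in> verts G - S" for u v
    using that adj
    by (auto simp: neighbors_def common_neighbors_def delete_verts_def adjacent_commute)
  moreover have "m \<le> c - 1 \<longleftrightarrow> m < c" for m
    using assms by auto
  moreover have "verts (delete_verts G S) = verts G - S"
    by (simp add: delete_verts_def)
  ultimately show ?thesis
    using adj by (simp add: c_closed_def closed_on_def)
qed

lemma c_closed_vertex_deletion_iff:
  assumes "1 \<le> c"
  shows "c_closed_vertex_deletion c (G, k) \<longleftrightarrow> has_closed_deletion c k (verts G) (adjacent G)"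
  using assms
  by (simp add: c_closed_vertex_deletion_def has_closed_deletion_def c_closed_delete_verts)

section \<open>Greedy selection of tuples\<close>

definition extensions :: "'a list set \<Rightarrow> nat set \<Rightarrow> 'a list \<Rightarrow> 'a list set" where
  "extensions K I t = {t' \<in> K. \<forall>j\<in>I. t' ! j = t ! j}"

fun cap :: "nat \<Rightarrow> nat \<Rightarrow> nat \<Rightarrow> nat" where
  "cap d k 0 = 1"
| "cap d k (Suc j) = 1 + d * k * cap d k j"

declare cap.simps(2) [simp del]

definition capped :: "nat \<Rightarrow> nat \<Rightarrow> 'a list set \<Rightarrow> bool" where
  "capped d k K \<longleftrightarrow> (\<forall>I t. I \<subseteq> {..<d} \<and> length t = d \<longrightarrow>
     card (extensions K I t) \<le> cap d k (d - card I))"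

definition saturated :: "nat \<Rightarrow> nat \<Rightarrow> 'a list set \<Rightarrow> 'a list \<Rightarrow> bool" where
  "saturated d k K t \<longleftrightarrow> (\<exists>I \<subseteq> {..<d}. cap d k (d - card I) \<le> card (extensions K I t))"

lemma cap_le:
  assumes "1 \<le> k"
  shows "cap d k j \<le> (Suc d * k) ^ j"
proof (induction j)
  case (Suc j)
  have "1 \<le> k * (Suc d * k) ^ j"
    using assms by simp
  moreover have "d * k * cap d k j \<le> d * k * (Suc d * k) ^ j"
    using Suc by (rule mult_le_mono2)
  ultimately have "1 + d * k * cap d k j \<le> k * (Suc d * k) ^ j + d * k * (Suc d * k) ^ j"
    by (rule add_mono)
  also have "\<dots> = (Suc d * k) ^ Suc j"
    by (simp add: algebra_simps)
  finally show ?case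
    by (simp only: cap.simps)
qed simp

lemma power_le_cap:
  assumes "1 \<le> d"
  shows "k ^ j \<le> cap d k j"
proof (induction j)
  case (Suc j)
  have "k * k ^ j \<le> d * k * cap d k j"
    using assms Suc by (intro mult_le_mono) auto
  then show ?case
    by (simp only: power_Suc cap.simps)
qed simp

lemma finite_extensions: "finite K \<Longrightarrow> finite (extensions K I t)"
  by (simp add: extensions_def)

lemma extensions_insert:
  "extensions (insert t K) I t' =
     (if \<forall>j\<in>I. t' ! j = t ! j then insert t (extensions K I t') else extensions K I t')"
  by (auto simp: extensions_def)

lemma extensions_cong: "(\<And>j. j \<in> I \<Longrightarrow> t ! j = t' ! j) \<Longrightarrow> extensions K I t = extensions K I t'"
  by (auto simp: extensions_def)

lemma saturated_mono:
  assumes "saturated d k K t" "K \<subseteq> K'" "finite K'"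
  shows "saturated d k K' t"
proof -
  have "card (extensions K I t) \<le> card (extensions K' I t)" for I
    using assms by (intro card_mono finite_extensions) (auto simp: extensions_def)
  then show ?thesis
    using assms(1) unfolding saturated_def by (meson order_trans)
qed

lemma saturated_insert:
  assumes "finite K"
  shows "saturated d k (insert t K) t"
  unfolding saturated_def
proof (intro exI conjI)
  have "0 < card (extensions (insert t K) {..<d} t)"
    using assms by (simp add: extensions_insert card_gt_0_iff finite_extensions)
  then show "cap d k (d - card {..<d}) \<le> card (extensions (insert t K) {..<d} t)"
    by simp
qed simp

lemma card_extensions_le_if_hit:
  assumes "finite K" and length: "\<And>t'. t' \<in> K \<Longrightarrow> length t' = d" "length t = d"
    and hit: "\<And>t'. t' \<in> K \<Longrightarrow> set t' \<inter> S \<noteq> {}" and miss: "\<And>i. i \<in> I \<Longrightarrow> t ! i \<notin> S"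
    and S: "finite S" "card S \<le> k"
    and bound: "\<And>i x. i < d \<Longrightarrow> i \<notin> I \<Longrightarrow> card (extensions K (insert i I) (t[i := x])) \<le> b"
  shows "card (extensions K I t) \<le> d * k * b"
proof -
  let ?R = "({..<d} - I) \<times> S"
  let ?F = "\<lambda>(i, x). extensions K (insert i I) (t[i := x])"
  have "extensions K I t \<subseteq> (\<Union>p\<in>?R. ?F p)"
  proof
    fix t' assume "t' \<in> extensions K I t"
    then have t': "t' \<in> K" "\<And>j. j \<in> I \<Longrightarrow> t' ! j = t ! j"
      by (auto simp: extensions_def)
    obtain i where i: "i < d" "t' ! i \<in> S"
      using hit[OF t'(1)] length(1)[OF t'(1)] by (metis disjoint_iff in_set_conv_nth)
    then have "i \<notin> I"
      using t'(2) miss by metis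
    moreover have "t' \<in> ?F (i, t' ! i)"
      using t' i length(2) \<open>i \<notin> I\<close> by (auto simp: extensions_def nth_list_update)
    ultimately show "t' \<in> (\<Union>p\<in>?R. ?F p)"
      using i by blast
  qed
  then have "card (extensions K I t) \<le> card (\<Union>p\<in>?R. ?F p)"
    using S \<open>finite K\<close> by (intro card_mono) (auto simp: finite_extensions)
  also have "\<dots> \<le> (\<Sum>p\<in>?R. card (?F p))"
    using S by (intro card_UN_le) auto
  also have "\<dots> \<le> (\<Sum>p\<in>?R. b)"
    using bound by (intro sum_mono) auto
  also have "\<dots> = card ({..<d} - I) * card S * b"
    by (simp add: card_cartesian_product)
  also have "\<dots> \<le> d * k * b"
    using S(2) card_mono[of "{..<d}" "{..<d} - I"] by (intro mult_le_mono) auto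
  finally show ?thesis .
qed

lemma hits_saturated:
  assumes "finite K" "capped d k K" "saturated d k K t"
    and length: "\<And>t'. t' \<in> K \<Longrightarrow> length t' = d" "length t = d"
    and hit: "\<And>t'. t' \<in> K \<Longrightarrow> set t' \<inter> S \<noteq> {}" and S: "finite S" "card S \<le> k"
  shows "set t \<inter> S \<noteq> {}"
proof
  assume disjoint: "set t \<inter> S = {}"
  obtain I where I: "I \<subseteq> {..<d}" "cap d k (d - card I) \<le> card (extensions K I t)"
    using assms(3) by (auto simp: saturated_def)
  then have "finite I" "card I \<le> d"
    using finite_subset card_mono[of "{..<d}" I] by auto
  have miss: "t ! i \<notin> S" if "i \<in> I" for i
    using that I(1) disjoint length(2) nth_mem[of i t] by blast
  note extensions_le = card_extensions_le_if_hit[OF \<open>finite K\<close> length hit miss S]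
  show False
  proof (cases "card I = d")
    case True
    then have "I = {..<d}"
      using I(1) card_subset_eq[of "{..<d}" I] by simp
    then have "card (extensions K I t) = 0"
      using extensions_le[of I 0] by auto
    then show False
      using I(2) True by simp
  next
    case False
    then have cap: "cap d k (d - card I) = 1 + d * k * cap d k (d - Suc (card I))"
      using \<open>card I \<le> d\<close> by (metis Suc_diff_Suc cap.simps(2) le_neq_implies_less)
    have "card (extensions K I t) \<le> d * k * cap d k (d - Suc (card I))"
    proof (rule extensions_le)
      fix i x assume i: "i < d" "i \<notin> I"
      then have "card (extensions K (insert i I) (t[i := x])) \<le> cap d k (d - card (insert i I))"
        using assms(2) I(1) length(2) by (simp add: capped_def)
      then show "card (extensions K (insert i I) (t[i := x])) \<le> cap d k (d - Suc (card I))"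
        using i \<open>finite I\<close> by simp
    qed
    then show False
      using I(2) cap by linarith
  qed
qed

lemma capped_insert:
  assumes "capped d k K" "\<not> saturated d k K t" "finite K"
  shows "capped d k (insert t K)"
  unfolding capped_def
proof (intro allI impI)
  fix I and t' :: "'a list" assume I: "I \<subseteq> {..<d} \<and> length t' = d"
  show "card (extensions (insert t K) I t') \<le> cap d k (d - card I)"
  proof (cases "\<forall>j\<in>I. t' ! j = t ! j")
    case True
    then have "extensions K I t' = extensions K I t"
      by (intro extensions_cong) simp
    then have "extensions (insert t K) I t' = insert t (extensions K I t)"
      using True by (simp add: extensions_insert)
    moreover have "card (extensions K I t) < cap d k (d - card I)"
      using assms(2) I by (auto simp: saturated_def not_le)
    ultimately show ?thesis
      using assms(3) by (simp add: card_insert_if finite_extensions)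
  next
    case False
    then have "extensions (insert t K) I t' = extensions K I t'"
      by (simp only: extensions_insert if_False)
    then show ?thesis
      using assms(1) I by (simp add: capped_def)
  qed
qed

definition greedy_insert :: "nat \<Rightarrow> nat \<Rightarrow> 'a list \<Rightarrow> 'a list set \<Rightarrow> 'a list set" where
  "greedy_insert d k t K = (if saturated d k K t then K else insert t K)"

definition greedy :: "nat \<Rightarrow> nat \<Rightarrow> 'a list list \<Rightarrow> 'a list set" where
  "greedy d k ts = fold (greedy_insert d k) ts {}"

lemma greedy_Nil [simp]: "greedy d k [] = {}"
  by (simp add: greedy_def)

lemma greedy_snoc [simp]: "greedy d k (ts @ [t]) = greedy_insert d k t (greedy d k ts)"
  by (simp add: greedy_def)

lemma greedy_subset: "greedy d k ts \<subseteq> set ts"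
  by (induction ts rule: rev_induct) (auto simp: greedy_insert_def)

lemma finite_greedy: "finite (greedy d k ts)"
  using greedy_subset by (rule finite_subset) simp

lemma capped_greedy: "capped d k (greedy d k ts)"
proof (induction ts rule: rev_induct)
  case Nil
  show ?case
    by (simp add: capped_def extensions_def)
next
  case (snoc t ts)
  then show ?case
    by (simp add: greedy_insert_def capped_insert finite_greedy)
qed

lemma saturated_greedy: "t \<in> set ts \<Longrightarrow> saturated d k (greedy d k ts) t"
proof (induction ts rule: rev_induct)
  case (snoc t' ts)
  show ?case
  proof (cases "t = t'")
    case True
    then show ?thesis
      by (simp add: greedy_insert_def saturated_insert finite_greedy)
  next
    case False
    then have "saturated d k (greedy d k ts) t"
      using snoc by simp
    then show ?thesis
      by (rule saturated_mono) (auto simp: greedy_insert_def finite_greedy)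
  qed
qed simp

lemma hits_if_hits_greedy:
  assumes "\<And>t. t \<in> set ts \<Longrightarrow> length t = d"
    and "\<And>t. t \<in> greedy d k ts \<Longrightarrow> set t \<inter> S \<noteq> {}"
    and "finite S" "card S \<le> k" "t \<in> set ts"
  shows "set t \<inter> S \<noteq> {}"
  by (rule hits_saturated[OF finite_greedy capped_greedy saturated_greedy])
    (use assms greedy_subset in blast)+

lemma card_Union_greedy_le:
  assumes "\<And>t. t \<in> set ts \<Longrightarrow> length t = d"
  shows "card (\<Union> (set ` greedy d k ts)) \<le> d * cap d k d"
proof -
  have "extensions (greedy d k ts) {} (replicate d undefined) = greedy d k ts"
    by (simp add: extensions_def)
  then have card: "card (greedy d k ts) \<le> cap d k d"
    using capped_greedy[of d k ts] unfolding capped_def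
    by (metis card.empty diff_zero empty_subsetI length_replicate)
  have "card (\<Union> (set ` greedy d k ts)) \<le> (\<Sum>t\<in>greedy d k ts. card (set t))"
    using finite_greedy by (rule card_UN_le)
  also have "\<dots> \<le> (\<Sum>t\<in>greedy d k ts. d)"
  proof (rule sum_mono)
    fix t assume "t \<in> greedy d k ts"
    then have "length t = d"
      using assms greedy_subset by blast
    then show "card (set t) \<le> d"
      using card_length[of t] by simp
  qed
  also have "\<dots> \<le> d * cap d k d"
    using mult_le_mono2[OF card, of d] by (simp add: mult.commute)
  finally show ?thesis .
qed

section \<open>Candidate tuples\<close>

definition combinations :: "nat \<Rightarrow> 'a list \<Rightarrow> 'a list list" where
  "combinations r xs = filter (\<lambda>ys. length ys = r) (subseqs xs)"

lemma combinations_0: "combinations 0 xs = [[]]"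
  by (induction xs) (simp_all add: combinations_def Let_def filter_map comp_def)

lemma combinations_Suc_Nil: "combinations (Suc r) [] = []"
  by (simp add: combinations_def)

lemma combinations_Suc_Cons:
  "combinations (Suc r) (x # xs) = map ((#) x) (combinations r xs) @ combinations (Suc r) xs"
  by (simp add: combinations_def Let_def filter_map comp_def)

lemma combinations_Suc_drop:
  assumes "a \<le> length xs"
  shows "combinations (Suc r) (drop a xs) =
    concat (map (\<lambda>i. map ((#) (xs ! i)) (combinations r (drop (Suc i) xs))) [a..<length xs])"
  using assms
proof (induction a rule: inc_induct)
  case base
  show ?case
    by (simp add: combinations_Suc_Nil)
next
  case (step a)
  then show ?case
    by (simp add: Cons_nth_drop_Suc[symmetric] upt_conv_Cons combinations_Suc_Cons)
qed

lemma combinationsD: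
  assumes "ys \<in> set (combinations r xs)" "distinct xs"
  shows "length ys = r" "distinct ys" "set ys \<subseteq> set xs"
  using assms subseqs_distinctD[of ys xs] subseqs_powset[of xs] by (auto simp: combinations_def)

lemma ex_combination:
  assumes "distinct xs" "C \<subseteq> set xs"
  shows "\<exists>ys\<in>set (combinations (card C) xs). set ys = C"
proof -
  obtain ys where "ys \<in> set (subseqs xs)" "set ys = C"
    using subset_subseqs[OF assms(2)] by blast
  then show ?thesis
    using subseqs_distinctD[OF _ assms(1)] by (auto simp: combinations_def distinct_card)
qed

definition completions :: "nat \<Rightarrow> 'a list \<Rightarrow> nat \<Rightarrow> 'a list \<Rightarrow> 'a list list" where
  "completions r xs a pre = map ((@) pre) (combinations r (drop a xs))"

lemma completions_0: "completions 0 xs a pre = [pre]"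
  by (simp add: completions_def combinations_0)

lemma completions_Suc:
  assumes "a \<le> length xs"
  shows "completions (Suc r) xs a pre =
    concat (map (\<lambda>i. completions r xs (Suc i) (pre @ [xs ! i])) [a..<length xs])"
proof -
  have "(@) (pre @ [x]) = (\<lambda>ys. pre @ x # ys)" for x
    by auto
  then show ?thesis
    using assms by (simp add: completions_def combinations_Suc_drop map_concat comp_def)
qed

definition limited_common_neighbors :: "nat \<Rightarrow> 'a list \<Rightarrow> ('a \<Rightarrow> 'a \<Rightarrow> bool) \<Rightarrow> 'a \<Rightarrow> 'a \<Rightarrow> 'a list" where
  "limited_common_neighbors l vs adj u v = take l (filter (\<lambda>w. adj u w \<and> adj v w) vs)"

definition candidates_at :: "nat \<Rightarrow> nat \<Rightarrow> 'a list \<Rightarrow> ('a \<Rightarrow> 'a \<Rightarrow> bool) \<Rightarrow> 'a \<Rightarrow> 'a \<Rightarrow> 'a list list" where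
  "candidates_at c k vs adj u v = (if u \<noteq> v \<and> \<not> adj u v
     then completions c (limited_common_neighbors (k + c) vs adj u v) 0 [u, v] else [])"

definition candidates :: "nat \<Rightarrow> nat \<Rightarrow> 'a list \<Rightarrow> ('a \<Rightarrow> 'a \<Rightarrow> bool) \<Rightarrow> 'a list list" where
  "candidates c k vs adj = concat (map (\<lambda>u. concat (map (candidates_at c k vs adj u) vs)) vs)"

lemma set_limited_common_neighbors:
  "set (limited_common_neighbors l vs adj u v) \<subseteq> common_neighbors (set vs) adj u v"
  by (auto simp: limited_common_neighbors_def common_neighbors_def dest: in_set_takeD)

lemma distinct_limited_common_neighbors:
  "distinct vs \<Longrightarrow> distinct (limited_common_neighbors l vs adj u v)"
  by (simp add: limited_common_neighbors_def)

lemma candidates_obstruction: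
  assumes "distinct vs" "t \<in> set (candidates c k vs adj)"
  shows "obstruction c (set vs) adj t"
proof -
  obtain u v ws where "u \<in> set vs" "v \<in> set vs" "u \<noteq> v" "\<not> adj u v" "t = u # v # ws"
    and ws: "ws \<in> set (combinations c (limited_common_neighbors (k + c) vs adj u v))"
    using assms(2) by (auto simp: candidates_def candidates_at_def completions_def split: if_splits)
  then show ?thesis
    using combinationsD[OF ws distinct_limited_common_neighbors[OF assms(1)]]
      set_limited_common_neighbors[of "k + c" vs adj u v]
    unfolding obstruction_def by blast
qed

text \<open>
  Deleting at most \<open>k\<close> of the \<open>k + c\<close> listed common neighbors leaves \<open>c\<close> of them.
\<close>

lemma hits_obstruction_if_hits_candidates:
  assumes vs: "distinct vs" and S: "finite S" "card S \<le> k"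
    and hit: "\<And>t. t \<in> set (candidates c k vs adj) \<Longrightarrow> set t \<inter> S \<noteq> {}"
    and t: "obstruction c (set vs) adj t"
  shows "set t \<inter> S \<noteq> {}"
proof
  assume disjoint: "set t \<inter> S = {}"
  obtain u v ws where uv: "t = u # v # ws" "u \<in> set vs" "v \<in> set vs" "u \<noteq> v" "\<not> adj u v"
    and ws: "set ws \<subseteq> common_neighbors (set vs) adj u v" "distinct ws" "length ws = c"
    using t by (auto simp: obstruction_def)
  let ?L = "limited_common_neighbors (k + c) vs adj u v"
  have distinct: "distinct ?L"
    using vs by (rule distinct_limited_common_neighbors)
  have "c \<le> card (set ?L - S)"
  proof (cases "length ?L < k + c")
    case True
    then have "set ?L = common_neighbors (set vs) adj u v"
      by (auto simp: limited_common_neighbors_def common_neighbors_def)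
    then have "set ws \<subseteq> set ?L - S"
      using ws(1) disjoint uv(1) by auto
    then show ?thesis
      using ws(2,3) card_mono[of "set ?L - S" "set ws"] by (simp add: distinct_card)
  next
    case False
    then show ?thesis
      using S diff_card_le_card_Diff[OF S(1), of "set ?L"] distinct_card[OF distinct] by linarith
  qed
  then obtain C where C: "C \<subseteq> set ?L - S" "card C = c"
    by (meson obtain_subset_with_card_n)
  then obtain us where us: "us \<in> set (combinations c ?L)" "set us = C"
    using ex_combination[OF distinct, of C] by blast
  then have "u # v # us \<in> set (candidates c k vs adj)"
    using uv by (auto simp: candidates_def candidates_at_def completions_def)
  then have "set (u # v # us) \<inter> S \<noteq> {}"
    by (rule hit)
  then show False
    using disjoint uv(1) us(2) C(1) by auto
qed

section \<open>The kernel\<close>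

definition kernel_verts :: "nat \<Rightarrow> nat \<Rightarrow> 'a list \<Rightarrow> ('a \<Rightarrow> 'a \<Rightarrow> bool) \<Rightarrow> 'a list" where
  "kernel_verts c k vs adj =
     filter (\<lambda>v. v \<in> \<Union> (set ` greedy (c + 2) k (candidates c k vs adj))) vs"

lemma distinct_kernel_verts: "distinct vs \<Longrightarrow> distinct (kernel_verts c k vs adj)"
  by (simp add: kernel_verts_def)

lemma set_kernel_verts:
  assumes "distinct vs"
  shows "set (kernel_verts c k vs adj) = \<Union> (set ` greedy (c + 2) k (candidates c k vs adj))"
proof -
  have "\<Union> (set ` greedy (c + 2) k (candidates c k vs adj)) \<subseteq> set vs"
    using greedy_subset set_obstruction[OF candidates_obstruction[OF assms]] by blast
  then show ?thesis
    by (auto simp: kernel_verts_def)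
qed

lemma length_kernel_verts_le:
  assumes "distinct vs"
  shows "length (kernel_verts c k vs adj) \<le> (c + 2) * cap (c + 2) k (c + 2)"
proof -
  have "length (kernel_verts c k vs adj) = card (set (kernel_verts c k vs adj))"
    using distinct_kernel_verts[OF assms] by (simp add: distinct_card)
  also have "\<dots> \<le> (c + 2) * cap (c + 2) k (c + 2)"
    unfolding set_kernel_verts[OF assms]
    by (rule card_Union_greedy_le) (rule length_obstruction[OF candidates_obstruction[OF assms]])
  finally show ?thesis .
qed

lemma closed_on_Diff_if_closed_on_kernel_verts_Diff:
  assumes vs: "distinct vs" and S: "finite S" "card S \<le> k"
    and closed: "closed_on c (set (kernel_verts c k vs adj) - S) adj"
  shows "closed_on c (set vs - S) adj"
proof -
  have "set t \<inter> S \<noteq> {}" if t: "t \<in> greedy (c + 2) k (candidates c k vs adj)" for t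
  proof -
    have "obstruction c (set vs) adj t"
      using t greedy_subset candidates_obstruction[OF vs] by blast
    moreover have "set t \<subseteq> set (kernel_verts c k vs adj)"
      unfolding set_kernel_verts[OF vs] using t by blast
    ultimately show ?thesis
      using closed by (auto simp: closed_on_Diff_iff_hitting intro: obstruction_subset)
  qed
  moreover have "length t = c + 2" if "t \<in> set (candidates c k vs adj)" for t
    using that by (rule length_obstruction[OF candidates_obstruction[OF vs]])
  ultimately have "set t \<inter> S \<noteq> {}" if "t \<in> set (candidates c k vs adj)" for t
    using that S by (metis hits_if_hits_greedy)
  then show ?thesis
    unfolding closed_on_Diff_iff_hitting[OF finite_set]
    using hits_obstruction_if_hits_candidates[OF vs S] by blast
qed

lemma has_closed_deletion_kernel_verts:
  assumes vs: "distinct vs"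
  shows "has_closed_deletion c k (set (kernel_verts c k vs adj)) adj \<longleftrightarrow>
    has_closed_deletion c k (set vs) adj"
proof
  let ?W = "set (kernel_verts c k vs adj)"
  have W: "?W \<subseteq> set vs"
    by (auto simp: kernel_verts_def)
  show "has_closed_deletion c k (set vs) adj" if W_deletion: "has_closed_deletion c k ?W adj"
  proof -
    obtain S where S: "S \<subseteq> ?W" "card S \<le> k" "closed_on c (?W - S) adj"
      using W_deletion by (auto simp: has_closed_deletion_def)
    then have "closed_on c (set vs - S) adj"
      using closed_on_Diff_if_closed_on_kernel_verts_Diff[OF vs] finite_subset by blast
    then show ?thesis
      using S(1,2) W by (auto simp: has_closed_deletion_def)
  qed
  show "has_closed_deletion c k ?W adj" if deletion: "has_closed_deletion c k (set vs) adj"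
  proof -
    obtain S where S: "S \<subseteq> set vs" "card S \<le> k" "closed_on c (set vs - S) adj"
      using deletion by (auto simp: has_closed_deletion_def)
    have "closed_on c (?W - S \<inter> ?W) adj"
      by (rule closed_on_subset[OF S(3)]) (use W in auto)
    moreover have "card (S \<inter> ?W) \<le> k"
      using S(1,2) card_mono[of S "S \<inter> ?W"] finite_subset[OF S(1)] by simp
    ultimately show ?thesis
      by (auto simp: has_closed_deletion_def intro!: exI[of _ "S \<inter> ?W"])
  qed
qed

definition induced_by_list :: "'a graph \<Rightarrow> 'a list \<Rightarrow> nat graph" where
  "induced_by_list G vs = ({..<length vs},
     {{i, j} | i j. i < length vs \<and> j < length vs \<and> i \<noteq> j \<and> adjacent G (vs ! i) (vs ! j)})"

lemma adjacent_induced_by_list: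
  assumes "simple_graph G" "i < length vs" "j < length vs"
  shows "adjacent (induced_by_list G vs) i j \<longleftrightarrow> adjacent G (vs ! i) (vs ! j)"
proof -
  have "\<not> adjacent G u u" for u
    using assms(1) by (auto simp: simple_graph_def adjacent_def)
  then have "i \<noteq> j" if "adjacent G (vs ! i) (vs ! j)"
    using that by metis
  then have "adjacent G (vs ! i) (vs ! j) \<longleftrightarrow> {i, j} \<in> edges (induced_by_list G vs)"
    using assms(2,3) adjacent_commute[of G] unfolding induced_by_list_def
    by (fastforce simp: doubleton_eq_iff)
  then show ?thesis
    by (simp add: adjacent_def)
qed

lemma has_closed_deletion_induced_by_list:
  assumes "simple_graph G" "distinct vs"
  shows "has_closed_deletion c k {..<length vs} (adjacent (induced_by_list G vs)) \<longleftrightarrow>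
    has_closed_deletion c k (set vs) (adjacent G)"
proof -
  have "has_closed_deletion c k ((!) vs ` {..<length vs}) (adjacent G) \<longleftrightarrow>
      has_closed_deletion c k {..<length vs} (adjacent (induced_by_list G vs))"
    using assms
    by (intro has_closed_deletion_inj_image)
      (auto simp: adjacent_induced_by_list inj_on_def nth_eq_iff_index_eq)
  moreover have "(!) vs ` {..<length vs} = set vs"
    by (auto simp: in_set_conv_nth)
  ultimately show ?thesis
    by simp
qed

definition kernel :: "nat \<Rightarrow> nat graph \<times> nat \<Rightarrow> nat graph \<times> nat" where
  "kernel c = (\<lambda>(G, k). let n = card (verts G) in
     (if cap (c + 2) k (c + 2) < n
      then induced_by_list G (kernel_verts c k [0..<n] (adjacent G)) else G, k))"

lemma kernel_eq_if_card_le: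
  assumes "1 \<le> k" "card (verts G) \<le> k"
  shows "kernel c (G, k) = (G, k)"
proof -
  have "k \<le> k ^ (c + 2)"
    using assms(1) by (intro self_le_power) auto
  also have "\<dots> \<le> cap (c + 2) k (c + 2)"
    by (rule power_le_cap) simp
  finally show ?thesis
    using assms(2) by (simp add: kernel_def)
qed

lemma valid_instance_kernel:
  assumes "valid_instance (G, k)"
  shows "valid_instance (kernel c (G, k))"
  using assms
  by (auto simp: kernel_def valid_instance_def simple_graph_def induced_by_list_def Let_def)

lemma c_closed_vertex_deletion_kernel:
  assumes "1 \<le> c" "valid_instance (G, k)"
  shows "c_closed_vertex_deletion c (kernel c (G, k)) \<longleftrightarrow> c_closed_vertex_deletion c (G, k)"
proof -
  have G: "simple_graph G" "verts G = set [0..<card (verts G)]"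
    using assms(2) by (simp_all add: valid_instance_def atLeast0LessThan)
  have "verts (induced_by_list G vs) = {..<length vs}" for vs
    by (simp add: induced_by_list_def)
  then have "c_closed_vertex_deletion c
      (induced_by_list G (kernel_verts c k [0..<card (verts G)] (adjacent G)), k) \<longleftrightarrow>
      has_closed_deletion c k (set [0..<card (verts G)]) (adjacent G)"
    using G(1) distinct_upt
    by (simp only: c_closed_vertex_deletion_iff[OF assms(1)] has_closed_deletion_induced_by_list
      distinct_kernel_verts has_closed_deletion_kernel_verts)
  also have "\<dots> \<longleftrightarrow> c_closed_vertex_deletion c (G, k)"
    by (simp only: c_closed_vertex_deletion_iff[OF assms(1)] flip: G(2))
  finally show ?thesis
    by (simp add: kernel_def Let_def)
qed

lemma card_verts_kernel_le:
  assumes "valid_instance (G, k)"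
  shows "card (verts (fst (kernel c (G, k)))) \<le> (c + 2) * (c + 3) ^ (c + 2) * k ^ (c + 2)"
proof -
  let ?cap = "cap (c + 2) k (c + 2)"
  have "card (verts (fst (kernel c (G, k)))) \<le> (c + 2) * ?cap"
    using length_kernel_verts_le[of "[0..<card (verts G)]" c k "adjacent G"]
    by (auto simp: kernel_def induced_by_list_def Let_def)
  also have "\<dots> \<le> (c + 2) * (Suc (c + 2) * k) ^ (c + 2)"
    using assms by (intro mult_le_mono2 cap_le) (simp add: valid_instance_def)
  also have "Suc (c + 2) = c + 3"
    by simp
  finally show ?thesis
    by (simp only: power_mult_distrib mult.assoc)
qed

lemma instance_size_le:
  assumes "valid_instance (G, k)" "card (verts G) \<le> b"
  shows "instance_size (G, k) \<le> b + 2 ^ b + k"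
proof -
  have "finite (verts G)" "edges G \<subseteq> Pow (verts G)"
    using assms(1) by (auto simp: valid_instance_def simple_graph_def)
  then have "card (edges G) \<le> 2 ^ card (verts G)"
    using card_mono[of "Pow (verts G)" "edges G"] by (simp add: card_Pow)
  also have "\<dots> \<le> 2 ^ b"
    using assms(2) by (intro power_increasing) auto
  finally show ?thesis
    using assms(2) by (simp add: instance_size_def)
qed

lemma is_kernel_kernel:
  assumes "1 \<le> c"
  shows "is_kernel (c_closed_vertex_deletion c) (kernel c)"
proof -
  let ?b = "\<lambda>k. (c + 2) * (c + 3) ^ (c + 2) * k ^ (c + 2)"
  have "instance_size (kernel c (G, k)) \<le> ?b k + 2 ^ ?b k + k" if "valid_instance (G, k)" for G k
  proof -
    obtain H where "kernel c (G, k) = (H, k)"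
      by (simp add: kernel_def Let_def)
    then show ?thesis
      using instance_size_le[of H k "?b k"] valid_instance_kernel[OF that, of c]
        card_verts_kernel_le[OF that, of c] by simp
  qed
  then show ?thesis
    unfolding is_kernel_def
    using valid_instance_kernel c_closed_vertex_deletion_kernel[OF assms]
    by (intro exI[of _ "\<lambda>k. ?b k + 2 ^ ?b k + k"]) blast
qed

section \<open>Timed total correctness\<close>

definition runs :: "com \<Rightarrow> store \<Rightarrow> nat \<Rightarrow> (store \<Rightarrow> bool) \<Rightarrow> bool" where
  "runs P s T Q \<longleftrightarrow> (\<exists>t s'. exec P s t s' \<and> t \<le> T \<and> Q s')"

abbreviation assign :: "store \<Rightarrow> string \<Rightarrow> nat \<Rightarrow> nat \<Rightarrow> store" where
  "assign s x i v \<equiv> s(x := (s x)(i := v))"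

lemma runs_mono:
  assumes "runs P s T Q" "T \<le> T'" "\<And>s'. Q s' \<Longrightarrow> Q' s'"
  shows "runs P s T' Q'"
  using assms unfolding runs_def by (meson order_trans)

lemma runs_Skip [simp]: "runs Skip s T Q \<longleftrightarrow> 1 \<le> T \<and> Q s"
  unfolding runs_def by (metis exec.Skip exec_SkipE)

lemma runs_Write [simp]:
  "runs (Write x i a) s T Q \<longleftrightarrow> 1 \<le> T \<and> Q (assign s x (aval i s) (aval a s))"
  unfolding runs_def by (metis exec.Write exec_WriteE)

lemma runs_Seq:
  assumes "runs P s T\<^sub>1 R" "\<And>s'. R s' \<Longrightarrow> runs P' s' T\<^sub>2 Q" "T\<^sub>1 + T\<^sub>2 \<le> T"
  shows "runs (Seq P P') s T Q"
proof -
  obtain t s' where "exec P s t s'" "t \<le> T\<^sub>1" "R s'"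
    using assms(1) unfolding runs_def by blast
  moreover obtain t' s'' where "exec P' s' t' s''" "t' \<le> T\<^sub>2" "Q s''"
    using assms(2)[OF \<open>R s'\<close>] unfolding runs_def by blast
  ultimately show ?thesis
    using assms(3) exec.Seq unfolding runs_def by (meson add_mono order_trans)
qed

lemma runs_Write_Seq [simp]:
  "runs (Seq (Write x i a) P) s T Q \<longleftrightarrow>
     1 \<le> T \<and> runs P (assign s x (aval i s) (aval a s)) (T - 1) Q"
proof
  assume "runs (Seq (Write x i a) P) s T Q"
  then show "1 \<le> T \<and> runs P (assign s x (aval i s) (aval a s)) (T - 1) Q"
    unfolding runs_def by (force elim!: exec_SeqE exec_WriteE)
next
  assume "1 \<le> T \<and> runs P (assign s x (aval i s) (aval a s)) (T - 1) Q"
  then show "runs (Seq (Write x i a) P) s T Q"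
    by (intro runs_Seq[where T\<^sub>1 = 1 and R = "\<lambda>s'. s' = assign s x (aval i s) (aval a s)"]) auto
qed

lemma runs_Cond [simp]:
  "runs (Cond b P P') s T Q \<longleftrightarrow> 1 \<le> T \<and> runs (if bval b s then P else P') s (T - 1) Q"
proof
  assume "runs (Cond b P P') s T Q"
  then show "1 \<le> T \<and> runs (if bval b s then P else P') s (T - 1) Q"
    unfolding runs_def by (elim exE conjE exec_CondE) force+
next
  assume "1 \<le> T \<and> runs (if bval b s then P else P') s (T - 1) Q"
  then obtain t s' where "exec (if bval b s then P else P') s t s'" "1 + t \<le> T" "Q s'"
    unfolding runs_def by auto
  moreover have "exec (Cond b P P') s (1 + t) s'"
    using calculation(1) CondTrue CondFalse by (cases "bval b s") simp_all
  ultimately show "runs (Cond b P P') s T Q"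
    unfolding runs_def by blast
qed

abbreviation var :: "string \<Rightarrow> aexp" where
  "var x \<equiv> Read x (Const 0)"

abbreviation set_var :: "string \<Rightarrow> aexp \<Rightarrow> com" where
  "set_var x a \<equiv> Write x (Const 0) a"

abbreviation add_to_var :: "string \<Rightarrow> aexp \<Rightarrow> com" where
  "add_to_var x a \<equiv> set_var x (Add (var x) a)"

definition count_up :: "string \<Rightarrow> nat \<Rightarrow> aexp \<Rightarrow> com \<Rightarrow> com" where
  "count_up x j b P = While (Less (Read x (Const j)) b)
     (Seq P (Write x (Const j) (Add (Read x (Const j)) (Const 1))))"

definition for_loop :: "string \<Rightarrow> nat \<Rightarrow> aexp \<Rightarrow> aexp \<Rightarrow> com \<Rightarrow> com" where
  "for_loop x j a b P = Seq (Write x (Const j) a) (count_up x j b P)"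

lemma runs_count_up:
  assumes "Inv i s" "s x j = i" "i \<le> N"
    and step: "\<And>i s. i < N \<Longrightarrow> Inv i s \<Longrightarrow> s x j = i \<Longrightarrow>
      runs P s T (\<lambda>s'. s' x j = i \<and> Inv (Suc i) (assign s' x j (Suc i)))"
    and bound: "\<And>i s. Inv i s \<Longrightarrow> aval b s = N"
  shows "runs (count_up x j b P) s ((N - i) * (T + 2) + 1) (Inv N)"
  using assms(1-3)
proof (induction "N - i" arbitrary: i s)
  case 0
  then have "\<not> bval (Less (Read x (Const j)) b) s" "i = N"
    using bound[of i s] by auto
  then show ?case
    using exec.WhileFalse 0 unfolding runs_def count_up_def by (metis le_add2)
next
  case (Suc m)
  then have i: "i < N" "m = N - Suc i" "N - i = Suc (N - Suc i)"
    by simp_all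
  then have test: "bval (Less (Read x (Const j)) b) s"
    using bound[of i s] Suc by simp
  let ?W = "Write x (Const j) (Add (Read x (Const j)) (Const 1))"
  obtain t s' where s': "exec P s t s'" "t \<le> T" "s' x j = i" "Inv (Suc i) (assign s' x j (Suc i))"
    using step[OF i(1) Suc.prems(1,2)] unfolding runs_def by blast
  then have "exec ?W s' 1 (assign s' x j (Suc i))"
    using exec.Write[of x "Const j" "Add (Read x (Const j)) (Const 1)" s'] by simp
  then have body: "exec (Seq P ?W) s (t + 1) (assign s' x j (Suc i))"
    by (rule exec.Seq[OF s'(1)])
  obtain t' s'' where rest: "exec (count_up x j b P) (assign s' x j (Suc i)) t' s''"
    "t' \<le> (N - Suc i) * (T + 2) + 1" "Inv N s''"
    using Suc.hyps(1)[OF i(2) s'(4)] i(1) unfolding runs_def by auto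
  have "exec (count_up x j b P) s (1 + (t + 1) + t') s''"
    using exec.WhileTrue[OF test body] rest(1) by (simp add: count_up_def)
  moreover have "1 + (t + 1) + t' \<le> (N - i) * (T + 2) + 1"
    using rest(2) s'(2) unfolding i(3) by simp
  ultimately show ?case
    using rest(3) unfolding runs_def by blast
qed

lemma runs_for_loop:
  assumes init: "Inv (aval a s) (assign s x j (aval a s))" "aval a s \<le> N"
    and step: "\<And>i s. i < N \<Longrightarrow> Inv i s \<Longrightarrow> s x j = i \<Longrightarrow>
      runs P s T (\<lambda>s'. s' x j = i \<and> Inv (Suc i) (assign s' x j (Suc i)))"
    and bound: "\<And>i s. Inv i s \<Longrightarrow> aval b s = N"
    and post: "\<And>s. Inv N s \<Longrightarrow> Q s"
    and time: "N * (T + 2) + 2 \<le> T'"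
  shows "runs (for_loop x j a b P) s T' Q"
proof -
  have "runs (count_up x j b P) (assign s x j (aval a s)) ((N - aval a s) * (T + 2) + 1) (Inv N)"
    by (rule runs_count_up[OF init(1) _ init(2) step bound]) simp
  moreover have "(N - aval a s) * (T + 2) \<le> N * (T + 2)"
    by (intro mult_le_mono1) simp
  ultimately have "runs (count_up x j b P) (assign s x j (aval a s)) (T' - 1) Q"
    using time post by (auto elim!: runs_mono)
  then show ?thesis
    using time by (simp add: for_loop_def)
qed

definition seqs :: "com list \<Rightarrow> com" where
  "seqs Ps = foldr Seq Ps Skip"

lemma seqs_simps [simp]: "seqs [] = Skip" "seqs (P # Ps) = Seq P (seqs Ps)"
  by (simp_all add: seqs_def)

lemma runs_seqs:
  assumes "Inv 0 s" and step: "\<And>j s. j < m \<Longrightarrow> Inv j s \<Longrightarrow> runs (P j) s T (Inv (Suc j))"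
  shows "runs (seqs (map P [0..<m])) s (m * T + 1) (Inv m)"
proof -
  have "runs (seqs (map P [j..<m])) s ((m - j) * T + 1) (Inv m)" if "j \<le> m" "Inv j s" for j s
    using that
  proof (induction j arbitrary: s rule: inc_induct)
    case base
    then show ?case
      by simp
  next
    case (step j)
    have "m - j = Suc (m - Suc j)"
      using step by simp
    then have "runs (Seq (P j) (seqs (map P [Suc j..<m]))) s ((m - j) * T + 1) (Inv m)"
      using step by (intro runs_Seq[OF assms(2)]) auto
    then show ?case
      using step by (simp add: upt_conv_Cons)
  qed
  from this[of 0 s] show ?thesis
    using assms(1) by simp
qed

definition unchanged_except :: "string set \<Rightarrow> store \<Rightarrow> store \<Rightarrow> bool" where
  "unchanged_except X s s' \<longleftrightarrow> (\<forall>x. x \<notin> X \<longrightarrow> s' x = s x)"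

lemma unchanged_exceptD: "unchanged_except X s s' \<Longrightarrow> x \<notin> X \<Longrightarrow> s' x = s x"
  by (simp add: unchanged_except_def)

lemma unchanged_except_refl [simp]: "unchanged_except X s s"
  by (simp add: unchanged_except_def)

lemma unchanged_except_upd [simp]:
  "x \<in> X \<Longrightarrow> unchanged_except X s (s'(x := g)) \<longleftrightarrow> unchanged_except X s s'"
  by (auto simp: unchanged_except_def)

lemma unchanged_except_trans:
  "unchanged_except X s s' \<Longrightarrow> unchanged_except Y s' s'' \<Longrightarrow> X \<union> Y \<subseteq> Z \<Longrightarrow> unchanged_except Z s s''"
  unfolding unchanged_except_def by (metis Un_iff subsetD)

section \<open>Lists, multiples and matrices\<close>

definition holds_list :: "store \<Rightarrow> nat list \<Rightarrow> bool" where
  "holds_list s xs \<longleftrightarrow> s ''len'' 0 = length xs \<and> (\<forall>i<length xs. s ''list'' i = xs ! i)"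

lemma holds_list_upd [simp]:
  "x \<notin> {''len'', ''list''} \<Longrightarrow> holds_list (s(x := g)) xs \<longleftrightarrow> holds_list s xs"
  by (auto simp: holds_list_def)

definition push :: "aexp \<Rightarrow> com" where
  "push a = Seq (Write ''list'' (var ''len'') a) (add_to_var ''len'' (Const 1))"

lemma runs_push:
  assumes "holds_list s xs"
  shows "runs (push a) s 2 (\<lambda>s'.
    holds_list s' (xs @ [aval a s]) \<and> unchanged_except {''list'', ''len''} s s')"
  using assms by (auto simp: push_def holds_list_def nth_append less_Suc_eq)

definition collect :: "bexp \<Rightarrow> aexp \<Rightarrow> com" where
  "collect b a = Seq (set_var ''len'' (Const 0)) (for_loop ''i'' 0 (Const 0) (var ''n'')
     (Cond (Conj b (Less (var ''len'') a)) (push (var ''i'')) Skip))"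

lemma runs_collect:
  assumes size: "s ''n'' 0 = n"
    and test: "\<And>i s'. i < n \<Longrightarrow> unchanged_except {''list'', ''len'', ''i''} s s' \<Longrightarrow> s' ''i'' 0 = i \<Longrightarrow>
      bval b s' \<longleftrightarrow> P i"
    and limit: "\<And>s'. unchanged_except {''list'', ''len'', ''i''} s s' \<Longrightarrow> aval a s' = m"
  shows "runs (collect b a) s (5 * n + 3) (\<lambda>s'. holds_list s' (take m (filter P [0..<n])) \<and>
    unchanged_except {''list'', ''len'', ''i''} s s')"
proof -
  let ?F = "\<lambda>i. filter P [0..<i]"
  let ?P = "Cond (Conj b (Less (var ''len'') a)) (push (var ''i'')) Skip"
  let ?Inv = "\<lambda>i s'. holds_list s' (take m (?F i)) \<and>
    unchanged_except {''list'', ''len'', ''i''} s s'"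
  have "runs (for_loop ''i'' 0 (Const 0) (var ''n'') ?P) (assign s ''len'' 0 0)
    (5 * n + 2) (?Inv n)"
  proof (rule runs_for_loop[where Inv = ?Inv and N = n and T = 3])
    fix i s' assume i: "i < n" and inv: "?Inv i s'" and index: "s' ''i'' 0 = i"
    have bval: "bval (Conj b (Less (var ''len'') a)) s' \<longleftrightarrow> P i \<and> length (?F i) < m"
      using inv test[of i s'] i index limit by (auto simp: holds_list_def)
    show "runs ?P s' 3 (\<lambda>s'. s' ''i'' 0 = i \<and> ?Inv (Suc i) (assign s' ''i'' 0 (Suc i)))"
    proof (cases "P i \<and> length (?F i) < m")
      case True
      then have take: "take m (?F (Suc i)) = take m (?F i) @ [aval (var ''i'') s']"
        using index by (simp add: Suc_le_eq)
      have "runs (push (var ''i'')) s' 2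
        (\<lambda>s'. s' ''i'' 0 = i \<and> ?Inv (Suc i) (assign s' ''i'' 0 (Suc i)))"
      proof (rule runs_mono[OF runs_push[OF conjunct1[OF inv]] order_refl], elim conjE)
        fix s'' assume list: "holds_list s'' (take m (?F i) @ [aval (var ''i'') s'])"
          and frame: "unchanged_except {''list'', ''len''} s' s''"
        have "unchanged_except {''list'', ''len'', ''i''} s s''"
          using unchanged_except_trans[OF _ frame] inv by blast
        then show "s'' ''i'' 0 = i \<and> ?Inv (Suc i) (assign s'' ''i'' 0 (Suc i))"
          using list index unchanged_exceptD[OF frame, of "''i''"]
          by (simp del: upt_Suc add: take)
      qed
      then show ?thesis
        using True bval by simp
    next
      case False
      then have "take m (?F (Suc i)) = take m (?F i)"
        by auto
      then show ?thesis
        using False bval inv index by (auto simp del: upt_Suc)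
    qed
  qed (use size in \<open>auto simp: holds_list_def unchanged_except_def\<close>)
  then show ?thesis
    by (simp add: collect_def)
qed

definition multiples :: "string \<Rightarrow> com" where
  "multiples x = Seq (set_var ''acc'' (Const 0))
     (for_loop ''i'' 0 (Const 0) (Add (var ''n'') (Const 1))
       (Seq (Write x (var ''i'') (var ''acc'')) (add_to_var ''acc'' (var ''base''))))"

lemma runs_multiples:
  assumes "s ''n'' 0 = n" "x \<notin> {''n'', ''i'', ''acc'', ''base''}"
  shows "runs (multiples x) s (4 * n + 7) (\<lambda>s'. (\<forall>i\<le>n. s' x i = i * s ''base'' 0) \<and>
    s' ''acc'' 0 = Suc n * s ''base'' 0 \<and> unchanged_except {x, ''i'', ''acc''} s s')"
proof -
  let ?Inv = "\<lambda>i s'. (\<forall>j<i. s' x j = j * s ''base'' 0) \<and> s' ''acc'' 0 = i * s ''base'' 0 \<and>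
    unchanged_except {x, ''i'', ''acc''} s s'"
  have "runs (for_loop ''i'' 0 (Const 0) (Add (var ''n'') (Const 1))
      (Seq (Write x (var ''i'') (var ''acc'')) (add_to_var ''acc'' (var ''base''))))
    (assign s ''acc'' 0 0) (4 * n + 6) (?Inv (Suc n))"
    by (rule runs_for_loop[where Inv = ?Inv and N = "Suc n" and T = 2])
      (use assms in \<open>auto simp: less_Suc_eq unchanged_except_def\<close>)
  then show ?thesis
    by (simp add: multiples_def less_Suc_eq_le add.commute)
qed

definition holds_matrix :: "string \<Rightarrow> nat \<Rightarrow> (nat \<Rightarrow> nat \<Rightarrow> bool) \<Rightarrow> store \<Rightarrow> bool" where
  "holds_matrix x n adj s \<longleftrightarrow> (\<forall>i<n. \<forall>j<n. s x (i * n + j) = of_bool (adj i j))"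

lemma holds_matrix_iff:
  "holds_matrix x n adj s \<longleftrightarrow> (\<forall>p<n * n. s x p = of_bool (adj (p div n) (p mod n)))"
proof (intro iffI allI impI)
  fix p assume matrix: "holds_matrix x n adj s" and p: "p < n * n"
  then have "0 < n"
    by (cases n) auto
  then have "p div n < n" "p mod n < n"
    using p by (auto simp: less_mult_imp_div_less)
  then have "s x (p div n * n + p mod n) = of_bool (adj (p div n) (p mod n))"
    using matrix unfolding holds_matrix_def by blast
  then show "s x p = of_bool (adj (p div n) (p mod n))"
    by simp
next
  assume cells: "\<forall>p<n * n. s x p = of_bool (adj (p div n) (p mod n))"
  show "holds_matrix x n adj s"
    unfolding holds_matrix_def
  proof (intro allI impI)
    fix i j assume ij: "i < n" "j < n"
    then have "i * n + j < Suc i * n"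
      by simp
    also have "\<dots> \<le> n * n"
      using ij by (intro mult_le_mono1) simp
    finally show "s x (i * n + j) = of_bool (adj i j)"
      using cells ij by simp
  qed
qed

section \<open>Counters of partial tuples\<close>

text \<open>
  The counter of the kept tuples with prescribed entries at the positions in \<open>I\<close> is cell
  \<open>subtuple_code n I t\<close> of array \<open>''count''\<close>: in base \<open>Suc n\<close>, digit 0 marks a free position. Array
  \<open>power_table j\<close> holds the multiples \<open>v * Suc n ^ j\<close>, because the machine cannot multiply.
\<close>

definition subtuple_code :: "nat \<Rightarrow> nat set \<Rightarrow> nat list \<Rightarrow> nat" where
  "subtuple_code n I t = (\<Sum>j\<in>I. Suc (t ! j) * Suc n ^ j)"

lemma digit_sum_less:
  assumes "\<And>j. j < d \<Longrightarrow> p j \<le> (n::nat)"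
  shows "(\<Sum>j<d. p j * Suc n ^ j) < Suc n ^ d"
  using assms
proof (induction d)
  case (Suc d)
  have "(\<Sum>j<d. p j * Suc n ^ j) < Suc n ^ d"
    using Suc by simp
  moreover have "p d * Suc n ^ d \<le> n * Suc n ^ d"
    using Suc by (intro mult_le_mono1) simp
  ultimately have "(\<Sum>j<d. p j * Suc n ^ j) + p d * Suc n ^ d < Suc n ^ d + n * Suc n ^ d"
    by (rule add_less_le_mono)
  then show ?case
    by simp
qed simp

lemma digit_sum_inject:
  assumes "\<And>j. j < d \<Longrightarrow> p j \<le> (n::nat)" "\<And>j. j < d \<Longrightarrow> q j \<le> n"
    and "(\<Sum>j<d. p j * Suc n ^ j) = (\<Sum>j<d. q j * Suc n ^ j)" "j < d"
  shows "p j = q j"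
  using assms
proof (induction d arbitrary: j)
  case (Suc d)
  let ?p = "\<Sum>j<d. p j * Suc n ^ j" and ?q = "\<Sum>j<d. q j * Suc n ^ j"
  have less: "?p < Suc n ^ d" "?q < Suc n ^ d"
    using Suc.prems by (simp_all add: digit_sum_less)
  have sums: "?p + p d * Suc n ^ d = ?q + q d * Suc n ^ d"
    using Suc.prems(3) by simp
  have "(?p + p d * Suc n ^ d) mod Suc n ^ d = (?q + q d * Suc n ^ d) mod Suc n ^ d"
    by (simp only: sums)
  then have "?p = ?q"
    using less by (simp only: mod_mult_self1 mod_less)
  then have "p d = q d"
    using sums by simp
  moreover have "p j = q j" if "j < d"
    by (rule Suc.IH[OF _ _ \<open>?p = ?q\<close> that]) (simp_all add: Suc.prems(1,2))
  ultimately show ?case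
    using Suc.prems(4) less_Suc_eq by blast
qed simp

lemma subtuple_code_eq_digit_sum:
  assumes "I \<subseteq> {..<d}"
  shows "subtuple_code n I t = (\<Sum>j<d. (if j \<in> I then Suc (t ! j) else 0) * Suc n ^ j)"
proof -
  have "subtuple_code n I t = (\<Sum>j\<in>I. (if j \<in> I then Suc (t ! j) else 0) * Suc n ^ j)"
    by (simp add: subtuple_code_def)
  also have "\<dots> = (\<Sum>j<d. (if j \<in> I then Suc (t ! j) else 0) * Suc n ^ j)"
    using assms by (intro sum.mono_neutral_left) auto
  finally show ?thesis .
qed

lemma subtuple_code_eq_iff:
  assumes I: "I \<subseteq> {..<d}" "I' \<subseteq> {..<d}"
    and t: "length t = d" "set t \<subseteq> {..<n}" "length t' = d" "set t' \<subseteq> {..<n}"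
  shows "subtuple_code n I t = subtuple_code n I' t' \<longleftrightarrow> I = I' \<and> (\<forall>j\<in>I. t ! j = t' ! j)"
proof
  assume codes: "subtuple_code n I t = subtuple_code n I' t'"
  note digit_sums =
    codes[unfolded subtuple_code_eq_digit_sum[OF I(1)] subtuple_code_eq_digit_sum[OF I(2)]]
  have "t ! j < n" "t' ! j < n" if "j < d" for j
    using subsetD[OF t(2) nth_mem] subsetD[OF t(4) nth_mem] that by (simp_all add: t(1,3))
  then have digits: "(if j \<in> I then Suc (t ! j) else 0) = (if j \<in> I' then Suc (t' ! j) else 0)"
    if "j < d" for j
    by (intro digit_sum_inject[OF _ _ digit_sums that]) (simp_all add: Suc_le_eq)
  then have "j \<in> I \<longleftrightarrow> j \<in> I'" if "j < d" for j
    using digits[OF that] by (auto split: if_splits)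
  then have "I = I'"
    using I by blast
  moreover have "t ! j = t' ! j" if "j \<in> I" for j
    using digits[of j] \<open>I = I'\<close> that I by auto
  ultimately show "I = I' \<and> (\<forall>j\<in>I. t ! j = t' ! j)"
    by blast
next
  assume "I = I' \<and> (\<forall>j\<in>I. t ! j = t' ! j)"
  then show "subtuple_code n I t = subtuple_code n I' t'"
    by (auto simp: subtuple_code_def)
qed

definition power_table :: "nat \<Rightarrow> string" where
  "power_table j = replicate (Suc j) (CHR ''*'')"

lemma power_table_inject [simp]: "power_table i = power_table j \<longleftrightarrow> i = j"
  by (simp add: power_table_def del: replicate.simps)

lemma power_table_neq [simp]:
  assumes "ch \<noteq> CHR ''*''"
  shows "power_table j \<noteq> ch # x" "ch # x \<noteq> power_table j"
  using assms by (auto simp: power_table_def)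

definition holds_input :: "nat \<Rightarrow> nat \<Rightarrow> (nat \<Rightarrow> nat \<Rightarrow> bool) \<Rightarrow> store \<Rightarrow> bool" where
  "holds_input n k adj s \<longleftrightarrow> s ''n'' 0 = n \<and> s ''k'' 0 = k \<and> holds_matrix ''A'' n adj s"

definition holds_tables :: "nat \<Rightarrow> nat \<Rightarrow> nat \<Rightarrow> store \<Rightarrow> bool" where
  "holds_tables d n k s \<longleftrightarrow> (\<forall>j\<le>d. s ''cap'' j = cap d k j) \<and> (\<forall>i\<le>n. s ''row'' i = i * n) \<and>
     (\<forall>j<d. \<forall>v\<le>n. s (power_table j) v = v * Suc n ^ j)"

definition holds_counts :: "nat \<Rightarrow> nat \<Rightarrow> nat list set \<Rightarrow> store \<Rightarrow> bool" where
  "holds_counts d n K s \<longleftrightarrow>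
     (\<forall>I t. I \<subseteq> {..<d} \<and> length t = d \<and> set t \<subseteq> {..<n} \<longrightarrow>
        s ''count'' (subtuple_code n I t) = card (extensions K I t)) \<and>
     (\<forall>v<n. s ''mark'' v = of_bool (v \<in> \<Union> (set ` K)))"

definition holds_selection ::
    "nat \<Rightarrow> nat \<Rightarrow> nat \<Rightarrow> (nat \<Rightarrow> nat \<Rightarrow> bool) \<Rightarrow> nat list set \<Rightarrow> store \<Rightarrow> bool" where
  "holds_selection d n k adj K s \<longleftrightarrow>
     finite K \<and> holds_input n k adj s \<and> holds_tables d n k s \<and> holds_counts d n K s"

lemma holds_selection_cong:
  assumes "unchanged_except X s s'" "X \<subseteq> {''tuple'', ''index'', ''list'', ''len'', ''i''}"
  shows "holds_selection d n k adj K s' \<longleftrightarrow> holds_selection d n k adj K s"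
proof -
  have "s' x = s x" if "x \<notin> {''tuple'', ''index'', ''list'', ''len'', ''i''}" for x
    using assms that by (auto simp: unchanged_except_def)
  then show ?thesis
    by (simp add: holds_selection_def holds_input_def holds_matrix_def holds_tables_def
        holds_counts_def)
qed

lemma holds_selection_upd [simp]:
  assumes "x \<in> {''tuple'', ''index'', ''list'', ''len'', ''i''}"
  shows "holds_selection d n k adj K (s(x := g)) \<longleftrightarrow> holds_selection d n k adj K s"
  by (rule holds_selection_cong[where X = "{x}"]) (use assms in simp_all)

lemma holds_selection_reads:
  assumes "holds_selection d n k adj K s"
  shows "s ''n'' 0 = n" "s ''k'' 0 = k" "i \<le> n \<Longrightarrow> s ''row'' i = i * n"
    "i < n \<Longrightarrow> j < n \<Longrightarrow> s ''A'' (i * n + j) = of_bool (adj i j)"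
  using assms by (auto simp: holds_selection_def holds_input_def holds_tables_def holds_matrix_def)

abbreviation entry :: "nat \<Rightarrow> aexp" where
  "entry j \<equiv> Read ''tuple'' (Const j)"

definition subtuple_address :: "nat list \<Rightarrow> aexp" where
  "subtuple_address js =
     foldr (\<lambda>j a. Add (Read (power_table j) (Add (entry j) (Const 1))) a) js (Const 0)"

lemma subseqs_upt:
  assumes "js \<in> set (subseqs [0..<d])"
  shows "distinct js" "set js \<subseteq> {..<d}" "card (set js) = length js"
  using assms subseqs_distinctD[of js "[0..<d]"] imageI[OF assms, of set]
  by (simp_all add: subseqs_powset atLeast0LessThan distinct_card)

lemma set_subseqs_upt: "set ` set (subseqs [0..<d]) = Pow {..<d}"
  by (simp add: subseqs_powset atLeast0LessThan)

lemma aval_subtuple_address: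
  assumes "holds_tables d n k s" "t = map (s ''tuple'') [0..<d]" "set t \<subseteq> {..<n}"
    and "js \<in> set (subseqs [0..<d])"
  shows "aval (subtuple_address js) s = subtuple_code n (set js) t"
  using subseqs_upt(1,2)[OF assms(4)]
proof (induction js)
  case (Cons j js)
  have "s ''tuple'' j < n"
    using assms(2,3) Cons.prems by (simp add: image_subset_iff)
  then show ?case
    using Cons assms(1,2)
    by (simp add: subtuple_address_def subtuple_code_def holds_tables_def Suc_le_eq)
qed (simp add: subtuple_address_def subtuple_code_def)

lemma subtuple_address_cong:
  assumes "unchanged_except {''count''} s s'"
  shows "aval (subtuple_address js) s' = aval (subtuple_address js) s"
  using unchanged_exceptD[OF assms] by (induction js) (simp_all add: subtuple_address_def)

definition unsaturated_test :: "nat \<Rightarrow> bexp" where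
  "unsaturated_test d = foldr (\<lambda>js b. Conj
     (Less (Read ''count'' (subtuple_address js)) (Read ''cap'' (Const (d - length js)))) b)
     (subseqs [0..<d]) (Less (Const 0) (Const 1))"

definition count_subtuples :: "nat list list \<Rightarrow> com" where
  "count_subtuples jss = seqs (map (\<lambda>js. let a = subtuple_address js in
     Write ''count'' a (Add (Read ''count'' a) (Const 1))) jss)"

definition mark_entries :: "nat list \<Rightarrow> com" where
  "mark_entries js = seqs (map (\<lambda>j. Write ''mark'' (entry j) (Const 1)) js)"

definition record_tuple :: "nat \<Rightarrow> com" where
  "record_tuple d = Seq (count_subtuples (subseqs [0..<d])) (mark_entries [0..<d])"

definition insert_tuple :: "nat \<Rightarrow> com" where
  "insert_tuple d = Cond (unsaturated_test d) (record_tuple d) Skip"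

lemma bval_foldr_Conj:
  "bval (foldr (\<lambda>x b. Conj (F x) b) xs (Less (Const 0) (Const 1))) s \<longleftrightarrow> (\<forall>x\<in>set xs. bval (F x) s)"
  by (induction xs) auto

lemma bval_unsaturated_test:
  assumes selection: "holds_selection d n k adj K s"
    and t: "t = map (s ''tuple'') [0..<d]" "set t \<subseteq> {..<n}"
  shows "bval (unsaturated_test d) s \<longleftrightarrow> \<not> saturated d k K t"
proof -
  have "bval (Less (Read ''count'' (subtuple_address js)) (Read ''cap'' (Const (d - length js)))) s
      \<longleftrightarrow> card (extensions K (set js) t) < cap d k (d - card (set js))"
    if js: "js \<in> set (subseqs [0..<d])" for js
  proof -
    have "s ''count'' (aval (subtuple_address js) s) = card (extensions K (set js) t)"
      using selection aval_subtuple_address[of d n k s t js] js subseqs_upt(2)[OF js] t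
      by (simp add: holds_selection_def holds_counts_def)
    then show ?thesis
      using selection subseqs_upt(3)[OF js] by (simp add: holds_selection_def holds_tables_def)
  qed
  then have "bval (unsaturated_test d) s \<longleftrightarrow>
      (\<forall>I\<in>set ` set (subseqs [0..<d]). card (extensions K I t) < cap d k (d - card I))"
    unfolding unsaturated_test_def bval_foldr_Conj by (simp cong: ball_cong)
  then show ?thesis
    unfolding set_subseqs_upt by (auto simp: saturated_def not_le)
qed

lemma runs_count_subtuples:
  assumes "distinct (map (\<lambda>js. aval (subtuple_address js) s) jss)"
  shows "runs (count_subtuples jss) s (length jss + 1) (\<lambda>s'.
    (\<forall>a. s' ''count'' a =
       s ''count'' a + of_bool (a \<in> (\<lambda>js. aval (subtuple_address js) s) ` set jss)) \<and>
    unchanged_except {''count''} s s')"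
  using assms
proof (induction jss arbitrary: s)
  case Nil
  then show ?case
    by (simp add: count_subtuples_def Let_def)
next
  case (Cons js jss)
  let ?a = "aval (subtuple_address js) s"
  let ?s = "assign s ''count'' ?a (Suc (s ''count'' ?a))"
  have addresses: "aval (subtuple_address js') ?s = aval (subtuple_address js') s" for js'
    by (rule subtuple_address_cong) simp
  have "distinct (map (\<lambda>js. aval (subtuple_address js) ?s) jss)"
    unfolding addresses using Cons.prems by simp
  from Cons.IH[OF this] have "runs (count_subtuples jss) ?s (length jss + 1) (\<lambda>s'.
    (\<forall>a. s' ''count'' a =
       s ''count'' a + of_bool (a \<in> (\<lambda>js. aval (subtuple_address js) s) ` set (js # jss))) \<and>
    unchanged_except {''count''} s s')"
    unfolding addresses
    by (rule runs_mono) (use Cons.prems in \<open>auto simp: unchanged_except_def\<close>)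
  then show ?case
    by (simp add: count_subtuples_def Let_def)
qed

lemma runs_mark_entries:
  "runs (mark_entries js) s (length js + 1) (\<lambda>s'.
    (\<forall>v. s' ''mark'' v = (if v \<in> s ''tuple'' ` set js then 1 else s ''mark'' v)) \<and>
    unchanged_except {''mark''} s s')"
proof (induction js arbitrary: s)
  case Nil
  then show ?case
    by (simp add: mark_entries_def)
next
  case (Cons j js)
  let ?s = "assign s ''mark'' (s ''tuple'' j) 1"
  have "runs (mark_entries js) ?s (length js + 1) (\<lambda>s'.
    (\<forall>v. s' ''mark'' v = (if v \<in> s ''tuple'' ` set (j # js) then 1 else s ''mark'' v)) \<and>
    unchanged_except {''mark''} s s')"
    by (rule runs_mono[OF Cons.IH]) (auto simp: unchanged_except_def)
  then show ?case
    by (simp add: mark_entries_def)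
qed

definition has_recorded :: "nat \<Rightarrow> nat \<Rightarrow> nat list \<Rightarrow> store \<Rightarrow> store \<Rightarrow> bool" where
  "has_recorded d n t s s' \<longleftrightarrow>
     (\<forall>a. s' ''count'' a = s ''count'' a + of_bool (a \<in> (\<lambda>I. subtuple_code n I t) ` Pow {..<d})) \<and>
     (\<forall>v. s' ''mark'' v = (if v \<in> set t then 1 else s ''mark'' v)) \<and>
     unchanged_except {''count'', ''mark''} s s'"

lemma runs_record_tuple:
  assumes tables: "holds_tables d n k s"
    and t: "t = map (s ''tuple'') [0..<d]" "set t \<subseteq> {..<n}"
  shows "runs (record_tuple d) s (2 ^ d + d + 2) (has_recorded d n t s)"
  unfolding record_tuple_def
proof (rule runs_Seq[OF runs_count_subtuples])
  let ?address = "\<lambda>js. aval (subtuple_address js) s" and ?code = "\<lambda>I. subtuple_code n I t"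
  have address: "?address js = ?code (set js)" if "js \<in> set (subseqs [0..<d])" for js
    using aval_subtuple_address[OF tables t that] .
  then have "?address ` set (subseqs [0..<d]) = ?code ` set ` set (subseqs [0..<d])"
    by (simp add: image_image)
  then have addresses: "?address ` set (subseqs [0..<d]) = ?code ` Pow {..<d}"
    by (simp only: set_subseqs_upt)
  have "length t = d"
    using t(1) by simp
  then have "inj_on ?code (Pow {..<d})"
    using subtuple_code_eq_iff[OF _ _ _ t(2) _ t(2)] by (auto simp: inj_on_def)
  then have "inj_on ?code (set (map set (subseqs [0..<d])))"
    by (simp only: list.set_map set_subseqs_upt)
  then have "distinct (map ?code (map set (subseqs [0..<d])))"
    using distinct_set_subseqs[of "[0..<d]"] by (simp add: distinct_map del: map_map set_map)
  then show "distinct (map ?address (subseqs [0..<d]))"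
    using address by (simp add: comp_def cong: map_cong)
  fix s\<^sub>1
  assume counted:
    "(\<forall>a. s\<^sub>1 ''count'' a = s ''count'' a + of_bool (a \<in> ?address ` set (subseqs [0..<d]))) \<and>
     unchanged_except {''count''} s s\<^sub>1"
  then have frame\<^sub>1: "unchanged_except {''count''} s s\<^sub>1"
    by (rule conjunct2)
  have reads: "s\<^sub>1 ''tuple'' ` set [0..<d] = set t" "s\<^sub>1 ''mark'' = s ''mark''"
    using t(1) unchanged_exceptD[OF frame\<^sub>1] by simp_all
  note marked = runs_mark_entries[of "[0..<d]" s\<^sub>1, unfolded reads length_upt diff_zero]
  show "runs (mark_entries [0..<d]) s\<^sub>1 (d + 1) (has_recorded d n t s)"
  proof (rule runs_mono[OF marked order_refl], elim conjE)
    fix s\<^sub>2 assume "\<forall>v. s\<^sub>2 ''mark'' v = (if v \<in> set t then 1 else s ''mark'' v)"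
      and frame\<^sub>2: "unchanged_except {''mark''} s\<^sub>1 s\<^sub>2"
    moreover have "unchanged_except {''count'', ''mark''} s s\<^sub>2"
      using frame\<^sub>1 frame\<^sub>2 by (rule unchanged_except_trans) simp
    ultimately show "has_recorded d n t s s\<^sub>2"
      using counted unchanged_exceptD[OF frame\<^sub>2, of "''count''"]
      by (simp add: has_recorded_def addresses)
  qed
qed (simp add: length_subseqs)

lemma holds_counts_insert:
  assumes counts: "holds_counts d n K s" and K: "finite K" "t \<notin> K"
    and t: "length t = d" "set t \<subseteq> {..<n}" and recorded: "has_recorded d n t s s'"
  shows "holds_counts d n (insert t K) s'"
  unfolding holds_counts_def
proof (intro conjI allI impI)
  fix I t' assume I: "I \<subseteq> {..<d} \<and> length t' = d \<and> set t' \<subseteq> {..<n}"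
  then have "subtuple_code n I t' = subtuple_code n J t \<longleftrightarrow> I = J \<and> (\<forall>j\<in>I. t' ! j = t ! j)"
    if "J \<subseteq> {..<d}" for J
    using subtuple_code_eq_iff[of I d J t' n t] that t by simp
  then have "subtuple_code n I t' \<in> (\<lambda>I. subtuple_code n I t) ` Pow {..<d} \<longleftrightarrow>
      (\<forall>j\<in>I. t' ! j = t ! j)"
    using I by (auto simp: image_iff)
  moreover have "s ''count'' (subtuple_code n I t') = card (extensions K I t')"
    using counts I by (simp add: holds_counts_def)
  moreover have "t \<notin> extensions K I t'"
    using K(2) by (simp add: extensions_def)
  ultimately show "s' ''count'' (subtuple_code n I t') = card (extensions (insert t K) I t')"
    using K(1) recorded by (simp add: has_recorded_def extensions_insert finite_extensions)
next
  fix v assume "v < n"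
  then show "s' ''mark'' v = of_bool (v \<in> \<Union> (set ` insert t K))"
    using counts recorded by (auto simp: has_recorded_def holds_counts_def)
qed

lemma runs_insert_tuple:
  assumes selection: "holds_selection d n k adj K s"
    and t: "t = map (s ''tuple'') [0..<d]" "set t \<subseteq> {..<n}"
  shows "runs (insert_tuple d) s (2 ^ d + d + 3) (\<lambda>s'.
    holds_selection d n k adj (greedy_insert d k t K) s' \<and>
    unchanged_except {''count'', ''mark''} s s')"
proof (cases "saturated d k K t")
  case True
  then show ?thesis
    using selection bval_unsaturated_test[OF selection t]
    by (simp add: insert_tuple_def greedy_insert_def)
next
  case False
  have tables: "holds_tables d n k s" and counts: "holds_counts d n K s" and K: "finite K"
    using selection by (simp_all add: holds_selection_def)
  have "t \<notin> K"
    using False saturated_insert[OF K, of d k t] by (auto simp: insert_absorb)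
  have "runs (record_tuple d) s (2 ^ d + d + 2) (\<lambda>s'.
    holds_selection d n k adj (insert t K) s' \<and> unchanged_except {''count'', ''mark''} s s')"
  proof (rule runs_mono[OF runs_record_tuple[OF tables t] order_refl])
    fix s' assume recorded: "has_recorded d n t s s'"
    then have frame: "unchanged_except {''count'', ''mark''} s s'"
      by (simp add: has_recorded_def)
    have "holds_counts d n (insert t K) s'"
      by (rule holds_counts_insert[OF counts K \<open>t \<notin> K\<close> _ t(2) recorded]) (simp add: t(1))
    moreover have "holds_input n k adj s'" "holds_tables d n k s'"
      using selection unchanged_exceptD[OF frame]
      by (simp_all add: holds_selection_def holds_input_def holds_tables_def holds_matrix_def)
    ultimately show "holds_selection d n k adj (insert t K) s' \<and>
        unchanged_except {''count'', ''mark''} s s'"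
      using K frame by (simp add: holds_selection_def)
  qed
  then show ?thesis
    using False bval_unsaturated_test[OF selection t]
    by (simp add: insert_tuple_def greedy_insert_def)
qed

section \<open>Enumerating the candidates\<close>

definition choose_entry :: "nat \<Rightarrow> com \<Rightarrow> com" where
  "choose_entry p P = Seq (Write ''tuple'' (Const p) (Read ''list'' (Read ''index'' (Const p)))) P"

fun for_combinations :: "nat \<Rightarrow> nat \<Rightarrow> aexp \<Rightarrow> com" where
  "for_combinations d 0 a = insert_tuple d"
| "for_combinations d (Suc r) a = for_loop ''index'' (d - Suc r) a (var ''len'')
     (choose_entry (d - Suc r)
       (for_combinations d r (Add (Read ''index'' (Const (d - Suc r))) (Const 1))))"

definition combinations_time :: "nat \<Rightarrow> nat \<Rightarrow> nat \<Rightarrow> nat" where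
  "combinations_time d l r = (2 ^ d + d + 3) * (2 * l + 2) ^ r"

lemma combinations_time_Suc:
  assumes "m \<le> l"
  shows "m * (combinations_time d l r + 3) + 2 \<le> combinations_time d l (Suc r)"
proof -
  let ?T = "combinations_time d l r"
  have "3 \<le> ?T"
    using mult_le_mono[of 3 "2 ^ d + d + 3" 1 "(2 * l + 2) ^ r"]
    by (simp add: combinations_time_def)
  then have "l * (?T + 3) + 2 \<le> l * (?T + ?T) + (?T + ?T)"
    by (intro add_mono mult_le_mono2) simp_all
  also have "\<dots> = combinations_time d l (Suc r)"
    by (simp add: combinations_time_def algebra_simps)
  finally show ?thesis
    using mult_le_mono1[OF assms, of "?T + 3"] by linarith
qed

text \<open>
  The cells of \<open>''index''\<close> and \<open>''tuple''\<close> below the nesting depth \<open>p\<close> belong to the enclosing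
  loops.
\<close>

definition has_inserted :: "nat \<Rightarrow> nat \<Rightarrow> nat \<Rightarrow> (nat \<Rightarrow> nat \<Rightarrow> bool) \<Rightarrow>
    nat list set \<Rightarrow> nat list list \<Rightarrow> nat \<Rightarrow> store \<Rightarrow> store \<Rightarrow> bool" where
  "has_inserted d n k adj K ts p s s' \<longleftrightarrow>
     holds_selection d n k adj (fold (greedy_insert d k) ts K) s' \<and>
     unchanged_except {''count'', ''mark'', ''tuple'', ''index''} s s' \<and>
     (\<forall>q<p. s' ''tuple'' q = s ''tuple'' q \<and> s' ''index'' q = s ''index'' q)"

lemma runs_insert_tuple_has_inserted:
  assumes "holds_selection d n k adj K s" "t = map (s ''tuple'') [0..<d]" "set t \<subseteq> {..<n}"
  shows "runs (insert_tuple d) s (combinations_time d l 0) (has_inserted d n k adj K [t] d s)"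
  by (rule runs_mono[OF runs_insert_tuple[OF assms]])
    (auto simp: combinations_time_def has_inserted_def unchanged_except_def)

lemma runs_choose_entry:
  assumes inserted: "has_inserted d n k adj K ts p s s\<^sub>1"
    and i: "s\<^sub>1 ''index'' p = i"
    and P: "runs P (assign s\<^sub>1 ''tuple'' p (s\<^sub>1 ''list'' i)) T
      (has_inserted d n k adj (fold (greedy_insert d k) ts K) us (Suc p)
        (assign s\<^sub>1 ''tuple'' p (s\<^sub>1 ''list'' i)))"
  shows "runs (choose_entry p P) s\<^sub>1 (1 + T) (\<lambda>s'. s' ''index'' p = i \<and>
    has_inserted d n k adj K (ts @ us) p s (assign s' ''index'' p j))"
proof -
  have "s\<^sub>2 ''index'' p = i \<and> has_inserted d n k adj K (ts @ us) p s (assign s\<^sub>2 ''index'' p j)"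
    if "has_inserted d n k adj (fold (greedy_insert d k) ts K) us (Suc p)
      (assign s\<^sub>1 ''tuple'' p (s\<^sub>1 ''list'' i)) s\<^sub>2" for s\<^sub>2
    using that inserted i by (auto simp: has_inserted_def unchanged_except_def)
  then show ?thesis
    using runs_mono[OF P order_refl] i by (simp add: choose_entry_def)
qed

lemma has_inserted_assign_entry:
  assumes "has_inserted d n k adj K ts p s s\<^sub>1" "holds_list s ws" "i < length ws" "set ws \<subseteq> {..<n}"
    and "pre = map (s ''tuple'') [0..<p]" "set pre \<subseteq> {..<n}"
    and s': "s' = assign s\<^sub>1 ''tuple'' p (s\<^sub>1 ''list'' i)"
  shows "holds_selection d n k adj (fold (greedy_insert d k) ts K) s'" "holds_list s' ws"
    and "pre @ [ws ! i] = map (s' ''tuple'') [0..<Suc p]" "set (pre @ [ws ! i]) \<subseteq> {..<n}"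
proof -
  show "holds_selection d n k adj (fold (greedy_insert d k) ts K) s'"
    using assms(1) by (simp add: has_inserted_def s')
  have "s\<^sub>1 ''list'' = s ''list''" "s\<^sub>1 ''len'' = s ''len''"
    using assms(1) by (simp_all add: has_inserted_def unchanged_except_def)
  then show "holds_list s' ws" "pre @ [ws ! i] = map (s' ''tuple'') [0..<Suc p]"
    using assms(1-3,5) by (simp_all add: has_inserted_def holds_list_def s')
  show "set (pre @ [ws ! i]) \<subseteq> {..<n}"
    using assms(6) subsetD[OF assms(4) nth_mem[OF assms(3)]] by simp
qed

lemma runs_for_combinations:
  assumes "r \<le> d" "p = d - r" "holds_selection d n k adj K s" "holds_list s ws"
    and "set ws \<subseteq> {..<n}" "length ws \<le> l" "aval a s \<le> length ws"
    and "pre = map (s ''tuple'') [0..<p]" "set pre \<subseteq> {..<n}"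
  shows "runs (for_combinations d r a) s (combinations_time d l r)
    (has_inserted d n k adj K (completions r ws (aval a s) pre) p s)"
  using assms
proof (induction r arbitrary: K s a p pre)
  case 0
  then show ?case
    using runs_insert_tuple_has_inserted by (simp add: completions_0)
next
  case (Suc r)
  have depth: "d - Suc r = p" "Suc p = d - r"
    using Suc.prems(1,2) by simp_all
  let ?ts = "\<lambda>i. concat (map (\<lambda>j. completions r ws (Suc j) (pre @ [ws ! j])) [aval a s..<i])"
  let ?Inv = "\<lambda>i s'. aval a s \<le> i \<and> has_inserted d n k adj K (?ts i) p s s'"
  let ?a = "Add (Read ''index'' (Const p)) (Const 1)"
  show ?case
    unfolding for_combinations.simps depth(1)
  proof (rule runs_for_loop[where Inv = ?Inv and N = "length ws"])
    show "?Inv (aval a s) (assign s ''index'' p (aval a s))"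
      using Suc.prems(3) by (simp add: has_inserted_def)
    show "length ws * (1 + combinations_time d l r + 2) + 2 \<le> combinations_time d l (Suc r)"
      using combinations_time_Suc[OF Suc.prems(6), of d r] by (simp add: algebra_simps)
  next
    fix i s\<^sub>1 assume i: "i < length ws" "s\<^sub>1 ''index'' p = i" and inv: "?Inv i s\<^sub>1"
    let ?s = "assign s\<^sub>1 ''tuple'' p (s\<^sub>1 ''list'' i)"
    note state =
      has_inserted_assign_entry[OF conjunct2[OF inv] Suc.prems(4) i(1) Suc.prems(5,8,9) refl]
    have "runs (for_combinations d r ?a) ?s (combinations_time d l r)
      (has_inserted d n k adj (fold (greedy_insert d k) (?ts i) K)
        (completions r ws (aval ?a ?s) (pre @ [ws ! i])) (Suc p) ?s)"
      by (rule Suc.IH[OF _ depth(2) state(1,2) Suc.prems(5,6) _ state(3,4)])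
        (use Suc.prems(1) i in simp_all)
    then show "runs (choose_entry p (for_combinations d r ?a)) s\<^sub>1 (1 + combinations_time d l r)
      (\<lambda>s'. s' ''index'' p = i \<and> ?Inv (Suc i) (assign s' ''index'' p (Suc i)))"
      using runs_choose_entry[OF conjunct2[OF inv] i(2)] inv i(2) by simp
  next
    fix i s' assume "?Inv i s'"
    then show "aval (var ''len'') s' = length ws"
      using Suc.prems(4) by (simp add: has_inserted_def unchanged_except_def holds_list_def)
  qed (use Suc.prems(7) in \<open>simp_all add: completions_Suc\<close>)
qed

definition edge_test :: "aexp \<Rightarrow> aexp \<Rightarrow> bexp" where
  "edge_test a b = Less (Const 0) (Read ''A'' (Add (Read ''row'' a) b))"

lemma bval_edge_test:
  assumes "holds_selection d n k adj K s" "aval a s < n" "aval b s < n"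
  shows "bval (edge_test a b) s \<longleftrightarrow> adj (aval a s) (aval b s)"
  using assms by (simp add: edge_test_def holds_selection_reads)

definition collect_common_neighbors :: "nat \<Rightarrow> com" where
  "collect_common_neighbors c = collect
     (Conj (edge_test (entry 0) (var ''i'')) (edge_test (entry 1) (var ''i'')))
     (Add (var ''k'') (Const c))"

lemma runs_collect_common_neighbors:
  assumes selection: "holds_selection d n k adj K s"
    and uv: "s ''tuple'' 0 = u" "s ''tuple'' 1 = v" "u < n" "v < n"
  shows "runs (collect_common_neighbors c) s (5 * n + 3) (\<lambda>s'.
    holds_list s' (limited_common_neighbors (k + c) [0..<n] adj u v) \<and>
    unchanged_except {''list'', ''len'', ''i''} s s')"
  unfolding collect_common_neighbors_def limited_common_neighbors_def
proof (rule runs_collect)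
  fix i s' assume "i < n" "s' ''i'' 0 = i"
    and frame: "unchanged_except {''list'', ''len'', ''i''} s s'"
  moreover have "holds_selection d n k adj K s'"
    using selection holds_selection_cong[OF frame] by simp
  ultimately show "bval (Conj (edge_test (entry 0) (var ''i''))
      (edge_test (entry 1) (var ''i''))) s' \<longleftrightarrow> adj u i \<and> adj v i"
    using uv unchanged_exceptD[OF frame] by (simp add: bval_edge_test)
next
  fix s' assume "unchanged_except {''list'', ''len'', ''i''} s s'"
  then show "aval (Add (var ''k'') (Const c)) s' = k + c"
    using holds_selection_reads[OF selection] by (simp add: unchanged_except_def)
qed (rule holds_selection_reads[OF selection])

definition process_pair :: "nat \<Rightarrow> com" where
  "process_pair c =
    (let u = entry 0; v = entry 1 in
     Cond (Conj (Neg (Conj (Neg (Less u v)) (Neg (Less v u)))) (Neg (edge_test u v)))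
       (Seq (collect_common_neighbors c) (for_combinations (c + 2) c (Const 0)))
       Skip)"

definition pair_time :: "nat \<Rightarrow> nat \<Rightarrow> nat \<Rightarrow> nat" where
  "pair_time c n k = 5 * n + 4 + combinations_time (c + 2) (k + c) c"

lemma runs_process_pair:
  assumes selection: "holds_selection (c + 2) n k adj K s"
    and uv: "s ''tuple'' 0 = u" "s ''tuple'' 1 = v" "u < n" "v < n"
  shows "runs (process_pair c) s (pair_time c n k) (\<lambda>s'.
    holds_selection (c + 2) n k adj
      (fold (greedy_insert (c + 2) k) (candidates_at c k [0..<n] adj u v) K) s' \<and>
    s' ''tuple'' 0 = u \<and> s' ''tuple'' 1 = v)"
    (is "runs _ _ _ ?Q")
proof (cases "u \<noteq> v \<and> \<not> adj u v")
  case False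
  moreover have "2 \<le> pair_time c n k"
    by (simp add: pair_time_def)
  ultimately show ?thesis
    using selection uv bval_edge_test[OF selection]
    by (auto simp: process_pair_def Let_def candidates_at_def)
next
  case True
  let ?ws = "limited_common_neighbors (k + c) [0..<n] adj u v"
  let ?T = "combinations_time (c + 2) (k + c) c"
  have "runs (Seq (collect_common_neighbors c) (for_combinations (c + 2) c (Const 0))) s
    (5 * n + 3 + ?T) ?Q"
  proof (rule runs_Seq[OF runs_collect_common_neighbors[OF selection uv] _ order_refl], elim conjE)
    fix s' assume list: "holds_list s' ?ws"
      and frame: "unchanged_except {''list'', ''len'', ''i''} s s'"
    have "runs (for_combinations (c + 2) c (Const 0)) s' ?T
      (has_inserted (c + 2) n k adj K (completions c ?ws (aval (Const 0) s') [u, v]) 2 s')"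
    proof (rule runs_for_combinations)
      show "holds_selection (c + 2) n k adj K s'"
        using selection holds_selection_cong[OF frame] by simp
      show "[u, v] = map (s' ''tuple'') [0..<2]"
        using uv unchanged_exceptD[OF frame] by (simp add: upt_rec)
      show "set ?ws \<subseteq> {..<n}"
        using set_limited_common_neighbors[of "k + c" "[0..<n]" adj u v]
        by (auto simp: common_neighbors_def)
    qed (use list uv in \<open>simp_all add: limited_common_neighbors_def\<close>)
    then show "runs (for_combinations (c + 2) c (Const 0)) s' ?T ?Q"
      using True uv unchanged_exceptD[OF frame]
      by (elim runs_mono) (simp_all add: has_inserted_def candidates_at_def)
  qed
  then show ?thesis
    using True uv bval_edge_test[OF selection, of "entry 0" "entry 1"]
    by (auto simp: process_pair_def Let_def pair_time_def elim!: runs_mono)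
qed

definition process_pairs :: "nat \<Rightarrow> com" where
  "process_pairs c = for_loop ''tuple'' 0 (Const 0) (var ''n'')
     (for_loop ''tuple'' 1 (Const 0) (var ''n'') (process_pair c))"

lemma runs_process_pairs:
  assumes selection: "holds_selection (c + 2) n k adj K s"
  shows "runs (process_pairs c) s (n * (n * (pair_time c n k + 2) + 2 + 2) + 2)
    (holds_selection (c + 2) n k adj
      (fold (greedy_insert (c + 2) k) (candidates c k [0..<n] adj) K))"
proof -
  let ?selection = "\<lambda>ts. holds_selection (c + 2) n k adj (fold (greedy_insert (c + 2) k) ts K)"
  let ?at = "candidates_at c k [0..<n] adj"
  define ts where "ts u = concat (map (\<lambda>u. concat (map (?at u) [0..<n])) [0..<u])" for u
  let ?Inv = "\<lambda>u v s'. s' ''tuple'' 0 = u \<and> ?selection (ts u @ concat (map (?at u) [0..<v])) s'"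
  have row: "runs (for_loop ''tuple'' 1 (Const 0) (var ''n'') (process_pair c)) s'
      (n * (pair_time c n k + 2) + 2)
      (\<lambda>s'. s' ''tuple'' 0 = u \<and> ?selection (ts (Suc u)) (assign s' ''tuple'' 0 (Suc u)))"
    if u: "u < n" "?selection (ts u) s'" "s' ''tuple'' 0 = u" for u s'
  proof (rule runs_for_loop[where Inv = "?Inv u" and N = n and T = "pair_time c n k"])
    show "?Inv u (aval (Const 0) s') (assign s' ''tuple'' 1 (aval (Const 0) s'))"
      using u by simp
  next
    fix v s'' assume v: "v < n" "?Inv u v s''" "s'' ''tuple'' 1 = v"
    then show "runs (process_pair c) s'' (pair_time c n k)
      (\<lambda>s'. s' ''tuple'' 1 = v \<and> ?Inv u (Suc v) (assign s' ''tuple'' 1 (Suc v)))"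
      using u(1) by (intro runs_mono[OF runs_process_pair[of c n k adj _ s'' u v]]) auto
  qed (auto simp: ts_def holds_selection_reads)
  have "runs (process_pairs c) s (n * (n * (pair_time c n k + 2) + 2 + 2) + 2) (?selection (ts n))"
    unfolding process_pairs_def
    by (rule runs_for_loop[where Inv = "\<lambda>u. ?selection (ts u)" and N = n,
          OF _ _ row _ _ order_refl])
      (use selection in \<open>simp_all add: ts_def holds_selection_reads\<close>)
  then show ?thesis
    by (simp add: ts_def candidates_def)
qed

section \<open>Tables and output\<close>

fun scale :: "nat \<Rightarrow> aexp \<Rightarrow> aexp" where
  "scale 0 a = Const 0"
| "scale (Suc d) a = Add a (scale d a)"

lemma aval_scale [simp]: "aval (scale d a) s = d * aval a s"
  by (induction d) auto

definition compute_cap :: "nat \<Rightarrow> nat \<Rightarrow> com" where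
  "compute_cap d j = Seq (set_var ''acc'' (Const 1))
     (Seq (for_loop ''i'' 0 (Const 0) (var ''k'')
         (add_to_var ''acc'' (scale d (Read ''cap'' (Const j)))))
       (Write ''cap'' (Const (Suc j)) (var ''acc'')))"

lemma runs_compute_cap:
  assumes "s ''k'' 0 = k"
  shows "runs (compute_cap d j) s (3 * k + 4) (\<lambda>s'.
    s' ''cap'' = (s ''cap'')(Suc j := 1 + d * k * s ''cap'' j) \<and>
    unchanged_except {''cap'', ''i'', ''acc''} s s')"
proof -
  let ?Inv = "\<lambda>i s'. s' ''acc'' 0 = 1 + d * i * s ''cap'' j \<and>
    unchanged_except {''i'', ''acc''} s s'"
  let ?loop = "for_loop ''i'' 0 (Const 0) (var ''k'')
    (add_to_var ''acc'' (scale d (Read ''cap'' (Const j))))"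
  have loop: "runs ?loop (assign s ''acc'' 0 1) (3 * k + 2) (?Inv k)"
    by (rule runs_for_loop[where Inv = ?Inv and N = k and T = 1])
      (use assms in \<open>auto simp: algebra_simps unchanged_except_def\<close>)
  have "runs (Seq ?loop (Write ''cap'' (Const (Suc j)) (var ''acc''))) (assign s ''acc'' 0 1)
    (3 * k + 3) (\<lambda>s'. s' ''cap'' = (s ''cap'')(Suc j := 1 + d * k * s ''cap'' j) \<and>
      unchanged_except {''cap'', ''i'', ''acc''} s s')"
    by (rule runs_Seq[where T\<^sub>2 = 1, OF loop]) (auto simp: unchanged_except_def)
  then show ?thesis
    by (simp add: compute_cap_def add.commute)
qed

definition compute_caps :: "nat \<Rightarrow> com" where
  "compute_caps d = Seq (set_var ''cap'' (Const 1)) (seqs (map (compute_cap d) [0..<d]))"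

lemma runs_compute_caps:
  assumes k: "s ''k'' 0 = k"
  shows "runs (compute_caps d) s (d * (3 * k + 4) + 2) (\<lambda>s'.
    (\<forall>j\<le>d. s' ''cap'' j = cap d k j) \<and> unchanged_except {''cap'', ''i'', ''acc''} s s')"
proof -
  let ?Inv = "\<lambda>i s'. (\<forall>j\<le>i. s' ''cap'' j = cap d k j) \<and>
    unchanged_except {''cap'', ''i'', ''acc''} s s'"
  have "runs (seqs (map (compute_cap d) [0..<d])) (assign s ''cap'' 0 1)
    (d * (3 * k + 4) + 1) (?Inv d)"
  proof (rule runs_seqs[where Inv = ?Inv])
    fix j s' assume inv: "?Inv j s'"
    then have "s' ''k'' 0 = k"
      using k by (simp add: unchanged_except_def)
    then show "runs (compute_cap d j) s' (3 * k + 4) (?Inv (Suc j))"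
      by (rule runs_mono[OF runs_compute_cap order_refl])
        (use inv in \<open>auto simp: cap.simps(2) le_Suc_eq intro: unchanged_except_trans\<close>)
  qed simp
  then show ?thesis
    by (simp add: compute_caps_def)
qed

definition compute_power_table :: "nat \<Rightarrow> com" where
  "compute_power_table j = Seq (multiples (power_table j)) (set_var ''base'' (var ''acc''))"

definition compute_power_tables :: "nat \<Rightarrow> com" where
  "compute_power_tables d = Seq (set_var ''base'' (Const 1))
     (seqs (map compute_power_table [0..<d]))"

lemma runs_compute_power_tables:
  assumes n: "s ''n'' 0 = n"
  shows "runs (compute_power_tables d) s (d * (4 * n + 8) + 2) (\<lambda>s'.
    (\<forall>j<d. \<forall>v\<le>n. s' (power_table j) v = v * Suc n ^ j) \<and>
    unchanged_except ({''base'', ''i'', ''acc''} \<union> range power_table) s s')"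
proof -
  let ?X = "{''base'', ''i'', ''acc''} \<union> range power_table"
  let ?Inv = "\<lambda>i s'. s' ''base'' 0 = Suc n ^ i \<and>
    (\<forall>j<i. \<forall>v\<le>n. s' (power_table j) v = v * Suc n ^ j) \<and> unchanged_except ?X s s'"
  have "runs (seqs (map compute_power_table [0..<d]))
    (assign s ''base'' 0 1) (d * (4 * n + 8) + 1) (?Inv d)"
  proof (rule runs_seqs[where Inv = ?Inv])
    fix j s' assume inv: "?Inv j s'"
    have "''n'' \<notin> ?X"
      by auto
    then have n': "s' ''n'' 0 = n"
      using n inv by (simp add: unchanged_except_def)
    show "runs (compute_power_table j) s' (4 * n + 8) (?Inv (Suc j))"
      unfolding compute_power_table_def
    proof (rule runs_Seq[OF runs_multiples[of s' n], where T\<^sub>2 = 1])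
      fix s'' assume s'': "(\<forall>i\<le>n. s'' (power_table j) i = i * s' ''base'' 0) \<and>
        s'' ''acc'' 0 = Suc n * s' ''base'' 0 \<and>
        unchanged_except {power_table j, ''i'', ''acc''} s' s''"
      then have "s'' (power_table i) v = v * Suc n ^ i" if "i < Suc j" "v \<le> n" for i v
        using that inv by (cases "i = j") (auto simp: unchanged_except_def)
      moreover have "unchanged_except ?X s s''"
        using s'' inv by (auto intro: unchanged_except_trans)
      ultimately show "runs (set_var ''base'' (var ''acc'')) s'' 1 (?Inv (Suc j))"
        using s'' inv by simp
    qed (use n' in simp_all)
  qed simp
  then show ?thesis
    by (simp add: compute_power_tables_def) (elim runs_mono; simp)
qed

definition compute_rows :: com where
  "compute_rows = Seq (set_var ''base'' (var ''n'')) (multiples ''row'')"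

definition compute_tables :: "nat \<Rightarrow> com" where
  "compute_tables d = Seq (compute_power_tables d) compute_rows"

lemma runs_compute_rows:
  assumes "s ''n'' 0 = n"
  shows "runs compute_rows s (4 * n + 8) (\<lambda>s'. (\<forall>i\<le>n. s' ''row'' i = i * n) \<and>
    unchanged_except {''row'', ''base'', ''i'', ''acc''} s s')"
proof -
  have "runs (multiples ''row'') (assign s ''base'' 0 n) (4 * n + 7) (\<lambda>s'.
    (\<forall>i\<le>n. s' ''row'' i = i * n) \<and> unchanged_except {''row'', ''base'', ''i'', ''acc''} s s')"
    by (rule runs_mono[OF runs_multiples[where n = n]])
      (use assms in \<open>auto simp: unchanged_except_def\<close>)
  then show ?thesis
    using assms by (simp add: compute_rows_def add.commute)
qed

lemma runs_compute_tables:
  assumes input: "holds_input n k adj s" and caps: "\<forall>j\<le>d. s ''cap'' j = cap d k j"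
    and zero: "s ''count'' = (\<lambda>_. 0)" "s ''mark'' = (\<lambda>_. 0)"
  shows "runs (compute_tables d) s (d * (4 * n + 8) + 4 * n + 10) (holds_selection d n k adj {})"
  unfolding compute_tables_def
proof (rule runs_Seq[OF runs_compute_power_tables])
  show n: "s ''n'' 0 = n"
    using input by (simp add: holds_input_def)
  fix s\<^sub>1
  assume s\<^sub>1: "(\<forall>j<d. \<forall>v\<le>n. s\<^sub>1 (power_table j) v = v * Suc n ^ j) \<and>
    unchanged_except ({''base'', ''i'', ''acc''} \<union> range power_table) s s\<^sub>1"
  have frame\<^sub>1: "s\<^sub>1 x = s x" if "x \<notin> {''base'', ''i'', ''acc''}" "x \<notin> range power_table" for x
    using unchanged_exceptD[OF conjunct2[OF s\<^sub>1]] that by blast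
  have "ch # x \<notin> range power_table" if "ch \<noteq> CHR ''*''" for ch x
    using that by auto
  then have reads\<^sub>1: "s\<^sub>1 ''n'' = s ''n''" "s\<^sub>1 ''k'' = s ''k''" "s\<^sub>1 ''A'' = s ''A''"
    "s\<^sub>1 ''cap'' = s ''cap''" "s\<^sub>1 ''count'' = s ''count''" "s\<^sub>1 ''mark'' = s ''mark''"
    by (simp_all add: frame\<^sub>1)
  have "s\<^sub>1 ''n'' 0 = n"
    using reads\<^sub>1 n by simp
  then have rows: "runs compute_rows s\<^sub>1 (4 * n + 8) (\<lambda>s'. (\<forall>i\<le>n. s' ''row'' i = i * n) \<and>
      unchanged_except {''row'', ''base'', ''i'', ''acc''} s\<^sub>1 s')"
    by (rule runs_compute_rows)
  show "runs compute_rows s\<^sub>1 (4 * n + 8) (holds_selection d n k adj {})"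
  proof (rule runs_mono[OF rows order_refl], elim conjE)
    fix s\<^sub>2
    assume rows: "\<forall>i\<le>n. s\<^sub>2 ''row'' i = i * n"
      and frame\<^sub>2: "unchanged_except {''row'', ''base'', ''i'', ''acc''} s\<^sub>1 s\<^sub>2"
    note reads = unchanged_exceptD[OF frame\<^sub>2] reads\<^sub>1
    have "holds_input n k adj s\<^sub>2"
      using input reads by (simp add: holds_input_def holds_matrix_def)
    moreover have "holds_tables d n k s\<^sub>2"
      using s\<^sub>1 rows caps reads by (simp add: holds_tables_def)
    moreover have "holds_counts d n {} s\<^sub>2"
      using zero reads by (simp add: holds_counts_def extensions_def)
    ultimately show "holds_selection d n k adj {} s\<^sub>2"
      by (simp add: holds_selection_def)
  qed
qed simp

definition copy_cell :: com where
  "copy_cell = Seq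
     (Write ''out'' (var ''acc'')
       (Read ''A'' (Add (Read ''row'' (Read ''list'' (entry 0))) (Read ''list'' (entry 1)))))
     (add_to_var ''acc'' (Const 1))"

definition copy_matrix :: com where
  "copy_matrix = Seq (set_var ''acc'' (Const 0))
     (for_loop ''tuple'' 0 (Const 0) (var ''len'')
       (for_loop ''tuple'' 1 (Const 0) (var ''len'') copy_cell))"

lemma runs_copy_matrix:
  assumes selection: "holds_selection d n k adj K s" and vs: "holds_list s vs" "set vs \<subseteq> {..<n}"
    and m: "m = length vs"
  shows "runs copy_matrix s (m * (m * 4 + 4) + 3) (\<lambda>s'. s' ''acc'' 0 = m * m \<and>
    holds_matrix ''out'' m (\<lambda>i j. adj (vs ! i) (vs ! j)) s' \<and>
    unchanged_except {''out'', ''tuple'', ''acc''} s s')"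
proof -
  let ?Inv = "\<lambda>q s'. s' ''acc'' 0 = q \<and>
    (\<forall>p<q. s' ''out'' p = of_bool (adj (vs ! (p div m)) (vs ! (p mod m)))) \<and>
    unchanged_except {''out'', ''tuple'', ''acc''} s s'"
  have len: "s ''len'' 0 = m"
    using vs m by (simp add: holds_list_def)
  have row: "runs (for_loop ''tuple'' 1 (Const 0) (var ''len'') copy_cell) s\<^sub>1 (m * 4 + 2)
      (\<lambda>s'. s' ''tuple'' 0 = i \<and> ?Inv (Suc i * m) (assign s' ''tuple'' 0 (Suc i)))"
    if i: "i < m" "?Inv (i * m) s\<^sub>1" "s\<^sub>1 ''tuple'' 0 = i" for i s\<^sub>1
  proof (rule runs_for_loop[where N = m and T = 2 and
        Inv = "\<lambda>j s'. s' ''tuple'' 0 = i \<and> ?Inv (i * m + j) s'"])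
    fix j s\<^sub>2 assume j: "j < m" "s\<^sub>2 ''tuple'' 1 = j"
      and inv: "s\<^sub>2 ''tuple'' 0 = i \<and> ?Inv (i * m + j) s\<^sub>2"
    have "s ''list'' i = vs ! i" "s ''list'' j = vs ! j"
      using vs(1) i(1) j(1) m by (simp_all add: holds_list_def)
    moreover have "vs ! i < n" "vs ! j < n"
      using vs(2) i(1) j(1) m nth_mem by blast+
    moreover have "(i * m + j) div m = i" "(i * m + j) mod m = j"
      using j(1) by simp_all
    ultimately show "runs copy_cell s\<^sub>2 2 (\<lambda>s'. s' ''tuple'' 1 = j \<and>
        (assign s' ''tuple'' 1 (Suc j)) ''tuple'' 0 = i \<and>
        ?Inv (i * m + Suc j) (assign s' ''tuple'' 1 (Suc j)))"
      using inv j(2) holds_selection_reads[OF selection]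
      by (simp add: copy_cell_def unchanged_except_def less_Suc_eq)
  qed (use i len in \<open>auto simp: unchanged_except_def add.commute\<close>)
  have "runs (for_loop ''tuple'' 0 (Const 0) (var ''len'')
      (for_loop ''tuple'' 1 (Const 0) (var ''len'') copy_cell))
    (assign s ''acc'' 0 0) (m * (m * 4 + 4) + 2) (?Inv (m * m))"
    by (rule runs_for_loop[where Inv = "\<lambda>i. ?Inv (i * m)" and N = m, OF _ _ row])
      (use len in \<open>auto simp: unchanged_except_def algebra_simps\<close>)
  then show ?thesis
    by (simp add: copy_matrix_def holds_matrix_iff)
qed

definition copy_back :: com where
  "copy_back = for_loop ''i'' 0 (Const 0) (var ''acc'')
     (Write ''A'' (var ''i'') (Read ''out'' (var ''i'')))"

lemma runs_copy_back:
  assumes "s ''acc'' 0 = m * m" "holds_matrix ''out'' m adj s"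
  shows "runs copy_back s (3 * (m * m) + 2)
    (\<lambda>s'. holds_matrix ''A'' m adj s' \<and> unchanged_except {''A'', ''i''} s s')"
  unfolding copy_back_def
  by (rule runs_for_loop[where N = "m * m" and T = 1 and
      Inv = "\<lambda>i s'. (\<forall>p<i. s' ''A'' p = s ''out'' p) \<and> unchanged_except {''A'', ''i''} s s'"])
    (use assms in \<open>auto simp: less_Suc_eq unchanged_except_def holds_matrix_iff\<close>)

definition collect_marked :: com where
  "collect_marked = collect (Less (Const 0) (Read ''mark'' (var ''i''))) (var ''n'')"

lemma runs_collect_marked:
  assumes selection: "holds_selection d n k adj K s"
  shows "runs collect_marked s (5 * n + 3) (\<lambda>s'.
    holds_list s' (filter (\<lambda>v. v \<in> \<Union> (set ` K)) [0..<n]) \<and>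
    unchanged_except {''list'', ''len'', ''i''} s s')"
proof -
  let ?vs = "filter (\<lambda>v. v \<in> \<Union> (set ` K)) [0..<n]"
  have "runs collect_marked s (5 * n + 3)
    (\<lambda>s'. holds_list s' (take n ?vs) \<and> unchanged_except {''list'', ''len'', ''i''} s s')"
    unfolding collect_marked_def
    by (rule runs_collect)
      (use selection holds_selection_reads[OF selection] in
        \<open>simp_all add: unchanged_except_def holds_selection_def holds_counts_def\<close>)
  moreover have "take n ?vs = ?vs"
    using length_filter_le[of _ "[0..<n]"] by simp
  ultimately show ?thesis
    by simp
qed

definition write_output :: com where
  "write_output = Seq collect_marked
     (Seq copy_matrix (Seq copy_back (set_var ''n'' (var ''len''))))"

lemma runs_write_output:
  assumes selection: "holds_selection d n k adj K s"
    and vs: "vs = filter (\<lambda>v. v \<in> \<Union> (set ` K)) [0..<n]"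
  shows "runs write_output s (7 * (n * n) + 9 * n + 9)
    (holds_input (length vs) k (\<lambda>i j. adj (vs ! i) (vs ! j)))"
  unfolding write_output_def
proof (rule runs_Seq[OF runs_collect_marked[OF selection, folded vs]], elim conjE)
  define m where "m = length vs"
  fix s\<^sub>1 assume list: "holds_list s\<^sub>1 vs"
    and frame\<^sub>1: "unchanged_except {''list'', ''len'', ''i''} s s\<^sub>1"
  have selection\<^sub>1: "holds_selection d n k adj K s\<^sub>1"
    using selection holds_selection_cong[OF frame\<^sub>1] by simp
  have "set vs \<subseteq> {..<n}"
    by (auto simp: vs)
  note copy = runs_copy_matrix[OF selection\<^sub>1 list this m_def]
  have "runs (Seq copy_matrix (Seq copy_back (set_var ''n'' (var ''len'')))) s\<^sub>1
    (7 * (m * m) + 4 * m + 6) (holds_input (length vs) k (\<lambda>i j. adj (vs ! i) (vs ! j)))"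
  proof (rule runs_Seq[OF copy], elim conjE)
    fix s\<^sub>2 assume out: "s\<^sub>2 ''acc'' 0 = m * m"
        "holds_matrix ''out'' m (\<lambda>i j. adj (vs ! i) (vs ! j)) s\<^sub>2"
      and frame\<^sub>2: "unchanged_except {''out'', ''tuple'', ''acc''} s\<^sub>1 s\<^sub>2"
    show "runs (Seq copy_back (set_var ''n'' (var ''len''))) s\<^sub>2 (3 * (m * m) + 3)
      (holds_input (length vs) k (\<lambda>i j. adj (vs ! i) (vs ! j)))"
      by (rule runs_Seq[OF runs_copy_back[OF out], where T\<^sub>2 = 1])
        (use list holds_selection_reads[OF selection\<^sub>1] frame\<^sub>2 in
          \<open>auto simp: holds_input_def holds_matrix_def holds_list_def m_def unchanged_except_def\<close>)
  qed (simp add: algebra_simps)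
  moreover have "m \<le> n"
    using length_filter_le[of _ "[0..<n]"] by (simp add: m_def vs)
  then have "m * m \<le> n * n"
    by (intro mult_le_mono)
  ultimately show "runs (Seq copy_matrix (Seq copy_back (set_var ''n'' (var ''len'')))) s\<^sub>1
    (7 * (n * n) + 4 * n + 6) (holds_input (length vs) k (\<lambda>i j. adj (vs ! i) (vs ! j)))"
    using \<open>m \<le> n\<close> by (elim runs_mono) simp_all
qed simp

section \<open>The kernelization\<close>

definition reduce :: "nat \<Rightarrow> com" where
  "reduce c = Seq (compute_tables (c + 2)) (Seq (process_pairs c) write_output)"

definition reduce_if_large :: "nat \<Rightarrow> com" where
  "reduce_if_large c = Cond (Less (Read ''cap'' (Const (c + 2))) (var ''n'')) (reduce c) Skip"

text \<open>
  The running time must not depend on \<open>k\<close>, so \<open>k < n\<close> is tested before the caps are computed in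
  time \<open>O(k)\<close>.
\<close>

definition kernelize :: "nat \<Rightarrow> com" where
  "kernelize c = Cond (Less (var ''k'') (var ''n''))
     (Seq (compute_caps (c + 2)) (reduce_if_large c)) Skip"

lemma stores_iff_holds_input:
  "stores s (G, k) \<longleftrightarrow> holds_input (card (verts G)) k (adjacent G) s"
  by (simp add: stores_def holds_input_def holds_matrix_def of_bool_def Let_def)

lemma stores_induced_by_list_iff:
  assumes "simple_graph G"
  shows "stores s (induced_by_list G vs, k) \<longleftrightarrow>
    holds_input (length vs) k (\<lambda>i j. adjacent G (vs ! i) (vs ! j)) s"
proof -
  have "card (verts (induced_by_list G vs)) = length vs"
    by (simp add: induced_by_list_def)
  then show ?thesis
    using adjacent_induced_by_list[OF assms]
    by (simp add: stores_iff_holds_input holds_input_def holds_matrix_def)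
qed

definition reduce_time :: "nat \<Rightarrow> nat \<Rightarrow> nat \<Rightarrow> nat" where
  "reduce_time c n k = ((c + 2) * (4 * n + 8) + 4 * n + 10) +
     ((n * (n * (pair_time c n k + 2) + 2 + 2) + 2) + (7 * (n * n) + 9 * n + 9))"

lemma runs_reduce:
  assumes input: "holds_input n k adj s" and caps: "\<forall>j\<le>c + 2. s ''cap'' j = cap (c + 2) k j"
    and zero: "s ''count'' = (\<lambda>_. 0)" "s ''mark'' = (\<lambda>_. 0)"
    and vs: "vs = kernel_verts c k [0..<n] adj"
  shows "runs (reduce c) s (reduce_time c n k)
    (holds_input (length vs) k (\<lambda>i j. adj (vs ! i) (vs ! j)))"
  unfolding reduce_def reduce_time_def
proof (rule runs_Seq[OF runs_compute_tables[OF input caps zero] _ order_refl],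
    rule runs_Seq[OF runs_process_pairs _ order_refl])
  fix s' assume "holds_selection (c + 2) n k adj
    (fold (greedy_insert (c + 2) k) (candidates c k [0..<n] adj) {}) s'"
  then show "runs write_output s' (7 * (n * n) + 9 * n + 9)
    (holds_input (length vs) k (\<lambda>i j. adj (vs ! i) (vs ! j)))"
    by (rule runs_write_output) (simp add: vs kernel_verts_def greedy_def)
qed simp_all

definition reduce_if_large_time :: "nat \<Rightarrow> nat \<Rightarrow> nat \<Rightarrow> nat" where
  "reduce_if_large_time c n k = 2 + (if cap (c + 2) k (c + 2) < n then reduce_time c n k else 0)"

lemma runs_reduce_if_large:
  assumes G: "simple_graph G" "n = card (verts G)"
    and input: "holds_input n k (adjacent G) s" and caps: "\<forall>j\<le>c + 2. s ''cap'' j = cap (c + 2) k j"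
    and zero: "s ''count'' = (\<lambda>_. 0)" "s ''mark'' = (\<lambda>_. 0)"
  shows "runs (reduce_if_large c) s (reduce_if_large_time c n k) (\<lambda>s'. stores s' (kernel c (G, k)))"
proof (cases "cap (c + 2) k (c + 2) < n")
  case True
  then have "runs (reduce c) s (reduce_time c n k) (\<lambda>s'. stores s' (kernel c (G, k)))"
    using runs_reduce[OF input caps zero refl] G
    by (simp add: kernel_def stores_induced_by_list_iff)
  then have "runs (reduce c) s (reduce_if_large_time c n k - 1) (\<lambda>s'. stores s' (kernel c (G, k)))"
    by (rule runs_mono) (use True in \<open>simp_all add: reduce_if_large_time_def\<close>)
  then show ?thesis
    using True input caps
    by (simp add: reduce_if_large_def holds_input_def reduce_if_large_time_def)
next
  case False
  then show ?thesis
    using input caps G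
    by (simp add: reduce_if_large_def reduce_if_large_time_def holds_input_def kernel_def
        stores_iff_holds_input)
qed

definition kernelization_time :: "nat \<Rightarrow> nat \<Rightarrow> nat \<Rightarrow> nat" where
  "kernelization_time c n k = 1 + ((c + 2) * (3 * n + 4) + 2 + reduce_if_large_time c n k)"

lemma runs_kernelize:
  assumes valid: "valid_instance (G, k)" and input: "input_store s (G, k)"
  shows "runs (kernelize c) s (kernelization_time c (card (verts G)) k)
    (\<lambda>s'. stores s' (kernel c (G, k)))"
proof -
  let ?n = "card (verts G)"
  have holds: "holds_input ?n k (adjacent G) s"
    using input by (simp add: input_store_def stores_iff_holds_input)
  then have reads: "s ''n'' 0 = ?n" "s ''k'' 0 = k"
    by (simp_all add: holds_input_def)
  show ?thesis
  proof (cases "k < ?n")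
    case True
    have unused: "s ''count'' = (\<lambda>_. 0)" "s ''mark'' = (\<lambda>_. 0)"
      using input by (simp_all add: fun_eq_iff input_store_def instance_cells_def)
    have "(c + 2) * (3 * k + 4) \<le> (c + 2) * (3 * ?n + 4)"
      using True by (intro mult_le_mono2) simp
    then have time: "(c + 2) * (3 * k + 4) + 2 + reduce_if_large_time c ?n k
        \<le> kernelization_time c ?n k - 1"
      by (simp only: kernelization_time_def diff_add_inverse add_le_mono1)
    have "runs (Seq (compute_caps (c + 2)) (reduce_if_large c)) s (kernelization_time c ?n k - 1)
      (\<lambda>s'. stores s' (kernel c (G, k)))"
    proof (rule runs_Seq[OF runs_compute_caps[of s k, OF reads(2)] _ time], elim conjE)
      fix s' assume caps: "\<forall>j\<le>c + 2. s' ''cap'' j = cap (c + 2) k j"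
        and frame: "unchanged_except {''cap'', ''i'', ''acc''} s s'"
      show "runs (reduce_if_large c) s' (reduce_if_large_time c ?n k)
        (\<lambda>s'. stores s' (kernel c (G, k)))"
      proof (rule runs_reduce_if_large[of G "?n" k s' c, OF _ refl _ caps])
        show "simple_graph G"
          using valid by (simp add: valid_instance_def)
        show "holds_input ?n k (adjacent G) s'"
          using holds unchanged_exceptD[OF frame] by (simp add: holds_input_def holds_matrix_def)
      qed (use unused unchanged_exceptD[OF frame] in simp_all)
    qed
    then show ?thesis
      using True reads by (simp add: kernelize_def kernelization_time_def)
  next
    case False
    then have "kernel c (G, k) = (G, k)"
      using valid by (intro kernel_eq_if_card_le) (simp_all add: valid_instance_def)
    then show ?thesis
      using False reads input by (simp add: kernelize_def kernelization_time_def input_store_def)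
  qed
qed

lemma pair_time_le:
  assumes "1 \<le> k" "cap (c + 2) k (c + 2) < n"
  shows "pair_time c n k + 2 \<le> ((2 ^ (c + 2) + (c + 2) + 3) * (2 * c + 4) ^ c + 5) * n + 6"
proof -
  let ?b = "2 ^ (c + 2) + (c + 2) + 3"
  have "k ^ c \<le> k ^ (c + 2)"
    using assms(1) by (intro power_increasing) auto
  also have "\<dots> \<le> n"
    using power_le_cap[of "c + 2" k "c + 2"] assms(2) by simp
  finally have "k ^ c \<le> n" .
  have "2 * (k + c) + 2 \<le> (2 * c + 4) * k"
    using assms(1) by (cases k) auto
  then have "(2 * (k + c) + 2) ^ c \<le> ((2 * c + 4) * k) ^ c"
    by (rule power_mono) simp
  also have "\<dots> \<le> (2 * c + 4) ^ c * n"
    unfolding power_mult_distrib using \<open>k ^ c \<le> n\<close> by (rule mult_le_mono2)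
  finally have "?b * (2 * (k + c) + 2) ^ c \<le> ?b * ((2 * c + 4) ^ c * n)"
    by (rule mult_le_mono2)
  then show ?thesis
    unfolding pair_time_def combinations_time_def distrib_right mult.assoc by linarith
qed

lemma kernelization_time_le:
  assumes "1 \<le> k"
  shows "kernelization_time c n k \<le>
    (12 * (c + 2) + (2 ^ (c + 2) + (c + 2) + 3) * (2 * c + 4) ^ c + 35) * (n ^ 3 + 1)"
proof -
  define d D where "d = c + 2" and "D = (2 ^ (c + 2) + (c + 2) + 3) * (2 * c + 4) ^ c"
  have powers: "n \<le> n ^ 3" "n * n \<le> n ^ 3"
    by (cases n; simp add: power3_eq_cube)+
  then have "d * n \<le> d * n ^ 3"
    by (intro mult_le_mono2)
  moreover have "reduce_if_large_time c n k \<le>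
      2 + 4 * (d * n) + 8 * d + 17 * n + 21 + (D + 5) * n ^ 3 + 13 * (n * n)"
  proof (cases "cap (c + 2) k (c + 2) < n")
    case True
    have "n * (pair_time c n k + 2) \<le> n * ((D + 5) * n + 6)"
      unfolding D_def using pair_time_le[OF assms True] by (rule mult_le_mono2)
    then have "n * (n * (pair_time c n k + 2) + 2 + 2) \<le> n * (n * ((D + 5) * n + 6) + 4)"
      by (intro mult_le_mono2) linarith
    also have "\<dots> = (D + 5) * n ^ 3 + 6 * (n * n) + 4 * n"
      by (simp add: algebra_simps power3_eq_cube)
    finally show ?thesis
      unfolding reduce_if_large_time_def reduce_time_def if_P[OF True]
      unfolding d_def[symmetric] distrib_left[of d]
      by linarith
  qed (simp add: reduce_if_large_time_def)
  ultimately have "kernelization_time c n k \<le> (12 * d + D + 35) * (n ^ 3 + 1)"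
    unfolding kernelization_time_def d_def[symmetric] distrib_left distrib_right
    using powers by linarith
  then show ?thesis
    by (simp only: d_def D_def)
qed

lemma computes_within_mono:
  assumes "computes_within P f T" "\<And>I. valid_instance I \<Longrightarrow> T I \<le> T' I"
  shows "computes_within P f T'"
  using assms unfolding computes_within_def by (meson order_trans)

lemma computes_within_kernelize:
  "computes_within (kernelize c) (kernel c) (\<lambda>(G, k). kernelization_time c (card (verts G)) k)"
  using runs_kernelize by (fastforce simp: computes_within_def runs_def)

theorem theorem5:
  fixes c :: nat
  assumes "c \<ge> 2"
  shows "\<exists>(f :: nat graph \<times> nat \<Rightarrow> nat graph \<times> nat) (P :: com) (A :: nat) (B :: nat).
    is_kernel (c_closed_vertex_deletion c) f \<and>
    (\<forall>G k. valid_instance (G, k) \<longrightarrow> card (verts (fst (f (G, k)))) \<le> A * k ^ (c + 2)) \<and>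
    computes_within P f (\<lambda>(G, k).
      let n = card (verts G); m = card (edges G) in B * (n ^ 3 + n ^ 2 * m + 1))"
proof (intro exI conjI)
  let ?B = "12 * (c + 2) + (2 ^ (c + 2) + (c + 2) + 3) * (2 * c + 4) ^ c + 35"
  show "is_kernel (c_closed_vertex_deletion c) (kernel c)"
    using assms by (intro is_kernel_kernel) simp
  show "\<forall>G k. valid_instance (G, k) \<longrightarrow>
      card (verts (fst (kernel c (G, k)))) \<le> ((c + 2) * (c + 3) ^ (c + 2)) * k ^ (c + 2)"
    using card_verts_kernel_le by blast
  show "computes_within (kernelize c) (kernel c) (\<lambda>(G, k).
      let n = card (verts G); m = card (edges G) in ?B * (n ^ 3 + n ^ 2 * m + 1))"
  proof (rule computes_within_mono[OF computes_within_kernelize], clarify)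
    fix G :: "nat graph" and k assume "valid_instance (G, k)"
    then have "kernelization_time c (card (verts G)) k \<le> ?B * (card (verts G) ^ 3 + 1)"
      by (intro kernelization_time_le) (simp add: valid_instance_def)
    also have "\<dots> \<le> ?B * (card (verts G) ^ 3 + card (verts G) ^ 2 * card (edges G) + 1)"
      by (intro mult_le_mono2) simp
    finally show "kernelization_time c (card (verts G)) k \<le>
        (let n = card (verts G); m = card (edges G) in ?B * (n ^ 3 + n ^ 2 * m + 1))"
      by (simp only: Let_def)
  qed
qed

end
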